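(* Let $n\ge 0$, $t\in\mathbb{F}_2^{n+1}$, and $R(n,t)=S(n)/I_{G_n^t}$. Then the image of $$X_n=x_0,\;x_2-x_3,\;x_4-x_5,\;\ldots,\;x_{2n}-x_{2n+1},\;x_{2n+2}-x_{2n+3},\;x_{2n+4}$$ in $R(n,t)$ is a system of parameters for $R(n,t)$.
   Context: Throughout, $k$ is a field. Ladder-like structures. For $n\ge 0$ and $t=(t_1,\dots,t_{n+1})\in\mathbb{F}_2^{n+1}$, $L_n^t$ is a partially filled array with $\lfloor n/2\rfloor+2$ rows (numbered top to bottom) and $\lceil n/2\rceil+2$ columns (numbered left to right); its nonzero entries are the variables $x_0,x_2,x_3,\dots,x_{2n+4}$ (there is no $x_1$), each occurring exactly once, all other positions being empty. It is defined recursively, with $\widehat t=(t_1,\dots,t_n)$: - $L_0^t$ has first row $x_0,x_2$ and second row $x_3,x_4$ (for both values of $t$). - $L_1^t$ has first row $x_0,x_2,x_5$ and second row $x_3,x_4,x_6$ (for all $t$). - For $n\ge 2$ even, $L_n^t$ is $L_{n-1}^{\widehat t}$ with a new bottom row added whose only nonzero entries are $x_{2n+4}$, in the last column, and $x_{2n+3}$, in the column containing the first (if $t_{n+1}=0$) or the second (if $t_{n+1}=1$) nonzero entry, from left to right, of the row immediately above the new row. - For $n\ge 3$ odd, $L_n^t$ is $L_{n-1}^{\widehat t}$ with a new rightmost column added whose only nonzero entries are $x_{2n+4}$, in the last row, and $x_{2n+3}$, in the row containing the first (if $t_{n+1}=0$) or the second (if $t_{n+1}=1$) nonzero entry, from top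 to bottom, of the column immediately to the left of the new column. Graphs and toric rings. $G_n^t$ is the bipartite graph with one vertex for each row and one vertex for each column of $L_n^t$, and, for each nonzero entry $x_j$ of $L_n^t$, one edge (called $x_j$) joining the vertex of its row to the vertex of its column. Let $V$ be its vertex set, $S(n)=k[x_0,x_2,x_3,\dots,x_{2n+4}]$ the polynomial ring on the edges, and $I_{G_n^t}$ (the toric ideal) the kernel of the $k$-algebra homomorphism $S(n)\to k[V]$ sending each edge to the product of its two endpoints. The toric ring is $R(n,t)=S(n)/I_{G_n^t}$, graded with all variables in degree 1. A system of parameters for the standard graded ring $R(n,t)$ is a sequence of $\dim R(n,t)$ homogeneous elements of positive degree such that the quotient of $R(n,t)$ by the ideal they generate has Krull dimension $0$. *)

theory Defs
  imports
    "HOL-Algebra.QuotRing"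
    "HOL-Library.Poly_Mapping"
    "HOL-Library.Extended_Real"
    "HOL-Library.Z2"
begin

section \<open>Krull dimension and systems of parameters\<close>

definition prime_chain :: "('a, 'b) ring_scheme \<Rightarrow> nat \<Rightarrow> bool" where
  "prime_chain R d \<longleftrightarrow>
     (\<exists>P. (\<forall>i\<le>d. primeideal (P i) R) \<and> (\<forall>i<d. P i \<subset> P (Suc i)))"

text \<open>
  The supremum is taken in the extended reals, so that the zero ring, which has no prime
  ideals, gets dimension \<open>-\<infinity>\<close> rather than \<open>0\<close>.
\<close>
definition krull_dim :: "('a, 'b) ring_scheme \<Rightarrow> ereal" where
  "krull_dim R = Sup {ereal (real d) | d. prime_chain R d}"

text \<open>
  \<open>A d\<close> is the homogeneous component of degree \<open>d\<close> of the graded ring \<open>R\<close>.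
\<close>
definition system_of_parameters ::
    "('a, 'b) ring_scheme \<Rightarrow> (nat \<Rightarrow> 'a set) \<Rightarrow> 'a list \<Rightarrow> bool" where
  "system_of_parameters R A xs \<longleftrightarrow>
     (\<forall>x \<in> set xs. \<exists>d>0. x \<in> A d) \<and>
     ereal (real (length xs)) = krull_dim R \<and>
     krull_dim (R Quot (Idl\<^bsub>R\<^esub> (set xs))) = 0"


section \<open>Polynomial rings\<close>

text \<open>Finitely supported maps from monomials (exponent vectors) to coefficients.\<close>
type_synonym ('x, 'k) mpoly = "('x \<Rightarrow>\<^sub>0 nat) \<Rightarrow>\<^sub>0 'k"

definition mconst :: "'k::zero \<Rightarrow> ('x, 'k) mpoly" where
  "mconst c = Poly_Mapping.single 0 c"

definition mvar :: "'x \<Rightarrow> ('x, 'k::zero_neq_one) mpoly" where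
  "mvar x = Poly_Mapping.single (Poly_Mapping.single x 1) 1"

definition poly_ring :: "'x set \<Rightarrow> ('x, 'k::comm_ring_1) mpoly ring" where
  "poly_ring X =
     \<lparr>carrier = {p. \<forall>m \<in> Poly_Mapping.keys p. Poly_Mapping.keys m \<subseteq> X},
      mult = (*), one = 1, zero = 0, add = (+)\<rparr>"

text \<open>The homomorphism of algebras that sends each variable \<open>x\<close> to \<open>f x\<close>.\<close>
definition poly_hom ::
    "('x \<Rightarrow> ('y, 'k) mpoly) \<Rightarrow> ('x, 'k::comm_ring_1) mpoly \<Rightarrow> ('y, 'k) mpoly" where
  "poly_hom f p =
     (\<Sum>m \<in> Poly_Mapping.keys p. mconst (Poly_Mapping.lookup p m) *
        (\<Prod>x \<in> Poly_Mapping.keys m. f x ^ Poly_Mapping.lookup m x))"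

definition homogeneous :: "nat \<Rightarrow> ('x, 'k::zero) mpoly \<Rightarrow> bool" where
  "homogeneous d p \<longleftrightarrow>
     (\<forall>m \<in> Poly_Mapping.keys p. (\<Sum>x \<in> Poly_Mapping.keys m. Poly_Mapping.lookup m x) = d)"


section \<open>Graphs and toric rings\<close>

record ('v, 'e) graph =
  verts :: "'v set"
  edges :: "'e set"
  ends :: "'e \<Rightarrow> 'v set"

definition toric_hom :: "('v, 'e) graph \<Rightarrow> ('e, 'k::field) mpoly \<Rightarrow> ('v, 'k) mpoly" where
  "toric_hom G = poly_hom (\<lambda>e. \<Prod>v \<in> ends G e. mvar v)"

definition toric_ideal :: "('v, 'e) graph \<Rightarrow> ('e, 'k::field) mpoly set" where
  "toric_ideal G = a_kernel (poly_ring (edges G)) (poly_ring (verts G)) (toric_hom G)"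

definition toric_ring :: "('v, 'e) graph \<Rightarrow> ('e, 'k::field) mpoly set ring" where
  "toric_ring G = poly_ring (edges G) Quot toric_ideal G"

definition toric_class ::
    "('v, 'e) graph \<Rightarrow> ('e, 'k::field) mpoly \<Rightarrow> ('e, 'k) mpoly set" where
  "toric_class G p = toric_ideal G +>\<^bsub>poly_ring (edges G)\<^esub> p"

definition toric_grading :: "('v, 'e) graph \<Rightarrow> nat \<Rightarrow> ('e, 'k::field) mpoly set set" where
  "toric_grading G d = toric_class G ` {p \<in> carrier (poly_ring (edges G)). homogeneous d p}"


section \<open>Ladder-like structures\<close>

definition num_rows :: "nat \<Rightarrow> nat" where
  "num_rows n = n div 2 + 2"

definition num_cols :: "nat \<Rightarrow> nat" where
  "num_cols n = (n + 1) div 2 + 2"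

text \<open>\<open>pick s A\<close> is the first (\<open>s = 0\<close>) or second (\<open>s = 1\<close>) element of \<open>A\<close>.\<close>
definition pick :: "bit \<Rightarrow> nat set \<Rightarrow> nat" where
  "pick s A = sorted_list_of_set A ! (if s = 0 then 0 else 1)"

text \<open>
  \<open>ladder n t\<close> maps a position (row, column), both counted from \<open>1\<close>, to the index \<open>j\<close> of
  the variable \<open>x\<^sub>j\<close> standing there, and is undefined at the empty positions.  The list
  \<open>t\<close> is \<open>[t\<^sub>1, \<dots>, t\<^sub>n\<^sub>+\<^sub>1]\<close>.
\<close>
fun ladder :: "nat \<Rightarrow> bit list \<Rightarrow> (nat \<times> nat) \<rightharpoonup> nat" where
  "ladder 0 t = [(1, 1) \<mapsto> 0, (1, 2) \<mapsto> 2, (2, 1) \<mapsto> 3, (2, 2) \<mapsto> 4]"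
| "ladder (Suc 0) t =
     [(1, 1) \<mapsto> 0, (1, 2) \<mapsto> 2, (1, 3) \<mapsto> 5, (2, 1) \<mapsto> 3, (2, 2) \<mapsto> 4, (2, 3) \<mapsto> 6]"
| "ladder (Suc (Suc m)) t =
     (let n = Suc (Suc m); L = ladder (Suc m) (butlast t); r = num_rows n; c = num_cols n
      in if even n
         then L((r, pick (last t) {j. (r - 1, j) \<in> dom L}) \<mapsto> 2 * n + 3, (r, c) \<mapsto> 2 * n + 4)
         else L((pick (last t) {i. (i, c - 1) \<in> dom L}, c) \<mapsto> 2 * n + 3, (r, c) \<mapsto> 2 * n + 4))"

definition bigraph :: "nat \<Rightarrow> bit list \<Rightarrow> (nat + nat, nat) graph" where
  "bigraph n t =
     \<lparr>verts = Inl ` {1..num_rows n} \<union> Inr ` {1..num_cols n},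
      edges = ran (ladder n t),
      ends = (\<lambda>e. \<Union>{{Inl r, Inr c} | r c. ladder n t (r, c) = Some e})\<rparr>"

text \<open>
  The sequence \<open>x\<^sub>0, x\<^sub>2 - x\<^sub>3, x\<^sub>4 - x\<^sub>5, \<dots>\<close>, ending with the difference of the variables
  numbered \<open>2n+2\<close> and \<open>2n+3\<close> and then the variable numbered \<open>2n+4\<close>.
\<close>
definition X_seq :: "nat \<Rightarrow> (nat, 'k::field) mpoly list" where
  "X_seq n = mvar 0 # map (\<lambda>i. mvar (2 * i) - mvar (2 * i + 1)) [1..<n + 2] @ [mvar (2 * n + 4)]"


section \<open>Every variable other than \<open>x\<^sub>1\<close> occurs exactly once\<close>

lemma pick_less_Max:
  assumes "finite A" "card A \<ge> 3"
  shows "pick s A \<in> A" "pick s A < Max A"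
proof -
  let ?l = "sorted_list_of_set A" and ?i = "if s = 0 then 0 else (1::nat)"
  have i: "?i < length ?l - 1" "length ?l - 1 < length ?l"
    using assms by auto
  show *: "pick s A \<in> A"
    unfolding pick_def using assms i nth_mem[of ?i ?l] by auto
  have "?l ! ?i < ?l ! (length ?l - 1)"
    using i strict_sorted_list_of_set[of A] sorted_wrt_nth_less by blast
  also have "?l ! (length ?l - 1) \<le> Max A"
    using assms i nth_mem[of "length ?l - 1" ?l] by auto
  finally show "pick s A < Max A" unfolding pick_def .
qed

lemma pick_less:
  assumes "A \<subseteq> {1..b}" "card A \<ge> 3"
  shows "pick s A \<in> A" "pick s A < b"
proof -
  have "finite A" "A \<noteq> {}" using assms finite_subset by fastforce+
  then show "pick s A \<in> A" "pick s A < b"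
    using pick_less_Max[of A s] assms Max_in[of A] by fastforce+
qed

lemma insert_two:
  assumes "inj_on L (dom L)" "p \<notin> dom L" "q \<notin> dom L" "p \<noteq> q" "u \<notin> ran L" "v \<notin> ran L" "u \<noteq> v"
  shows "inj_on (L(p \<mapsto> u, q \<mapsto> v)) (dom (L(p \<mapsto> u, q \<mapsto> v)))"
    "ran (L(p \<mapsto> u, q \<mapsto> v)) = insert u (insert v (ran L))"
proof -
  have "L x \<noteq> Some u" "L x \<noteq> Some v" for x using assms by (auto simp: ran_def)
  moreover have "L x = L y \<Longrightarrow> x \<in> dom L \<Longrightarrow> x = y" for x y
    using assms(1) by (metis domIff inj_onD)
  ultimately show "inj_on (L(p \<mapsto> u, q \<mapsto> v)) (dom (L(p \<mapsto> u, q \<mapsto> v)))"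
    using assms(4,7) by (force simp: inj_on_def split: if_splits)
  show "ran (L(p \<mapsto> u, q \<mapsto> v)) = insert u (insert v (ran L))"
    using assms by (subst ran_map_upd; auto simp: domIff)+
qed

definition ladder_inv :: "nat \<Rightarrow> (nat \<times> nat \<rightharpoonup> nat) \<Rightarrow> bool" where
  "ladder_inv n L \<longleftrightarrow>
     dom L \<subseteq> {1..num_rows n} \<times> {1..num_cols n} \<and>
     ran L = insert 0 {2..2 * n + 4} \<and>
     inj_on L (dom L) \<and>
     (num_rows n, num_cols n) \<in> dom L \<and>
     (odd n \<longrightarrow> (\<exists>i < num_rows n. (i, num_cols n) \<in> dom L)) \<and>
     (even n \<longrightarrow> (\<exists>j < num_cols n. (num_rows n, j) \<in> dom L)) \<and>
     (odd n \<longrightarrow> card {j. (num_rows n, j) \<in> dom L} \<ge> 3) \<and>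
     (even n \<and> n > 0 \<longrightarrow> card {i. (i, num_cols n) \<in> dom L} \<ge> 3)"

lemma ladder_inv_odd:
  assumes "odd n" "dom L \<subseteq> {1..num_rows n} \<times> {1..num_cols n}" "ran L = insert 0 {2..2 * n + 4}"
    "inj_on L (dom L)" "(num_rows n, num_cols n) \<in> dom L" "(i, num_cols n) \<in> dom L"
    "i < num_rows n" "card {j. (num_rows n, j) \<in> dom L} \<ge> 3"
  shows "ladder_inv n L"
  using assms unfolding ladder_inv_def by blast

lemma ladder_inv_even:
  assumes "even n" "dom L \<subseteq> {1..num_rows n} \<times> {1..num_cols n}" "ran L = insert 0 {2..2 * n + 4}"
    "inj_on L (dom L)" "(num_rows n, num_cols n) \<in> dom L" "(num_rows n, j) \<in> dom L"
    "j < num_cols n" "n > 0 \<Longrightarrow> card {i. (i, num_cols n) \<in> dom L} \<ge> 3"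
  shows "ladder_inv n L"
  using assms unfolding ladder_inv_def by blast

lemma ladder_inv_ladder: "ladder_inv n (ladder n t)"
proof (induction n t rule: ladder.induct)
  case (1 t)
  have "{2..4} = {2, 3, 4::nat}" by auto
  then have ran: "ran (ladder 0 t) = insert 0 {2..2 * 0 + 4}" by (simp add: insert_commute)
  have dom: "dom (ladder 0 t) = {(1, 1), (1, 2), (2, 1), (2, 2)}" by auto
  have inj: "inj_on (ladder 0 t) (dom (ladder 0 t))" unfolding dom by simp
  show ?case
    by (rule ladder_inv_even[where j = 1, OF _ _ ran inj])
      (unfold dom, auto simp: num_rows_def num_cols_def)
next
  case (2 t)
  have "{2..6} = {2, 3, 4, 5, 6::nat}" by auto
  then have ran: "ran (ladder (Suc 0) t) = insert 0 {2..2 * Suc 0 + 4}"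
    by (simp add: insert_commute)
  have dom: "dom (ladder (Suc 0) t) = {(1, 1), (1, 2), (1, 3), (2, 1), (2, 2), (2, 3)}" by auto
  have inj: "inj_on (ladder (Suc 0) t) (dom (ladder (Suc 0) t))" unfolding dom by simp
  have "{j. (2, j) \<in> dom (ladder (Suc 0) t)} = {1, 2, 3}" unfolding dom by auto
  then have card: "card {j. (num_rows (Suc 0), j) \<in> dom (ladder (Suc 0) t)} \<ge> 3"
    by (simp add: num_rows_def)
  show ?case
    by (rule ladder_inv_odd[where i = 1, OF _ _ ran inj _ _ _ card])
      (unfold dom, auto simp: num_rows_def num_cols_def)
next
  case (3 m t)
  define n where "n = Suc (Suc m)"
  define L where "L = ladder (Suc m) (butlast t)"
  define r where "r = num_rows n"
  define c where "c = num_cols n"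
  note IH = "3.IH"[OF n_def, folded L_def, unfolded ladder_inv_def]
  have ran: "ran L = insert 0 {2..2 * n + 2}" and inj: "inj_on L (dom L)"
    using IH by (auto simp: n_def)
  have new: "2 * n + 3 \<notin> ran L" "2 * n + 4 \<notin> ran L" "2 * n + 3 \<noteq> 2 * n + 4"
    using ran by auto
  have ran': "insert (2 * n + 3) (insert (2 * n + 4) (ran L)) = insert 0 {2..2 * n + 4}"
    unfolding ran by auto
  have "ladder_inv n (ladder n t)"
  proof (cases "even n")
    case True
    have d: "dom L \<subseteq> {1..r - 1} \<times> {1..c}" "(r - 1, c) \<in> dom L"
      and card: "card {j. (r - 1, j) \<in> dom L} \<ge> 3" and r: "r > 2"
      and "\<exists>i < r - 1. (i, c) \<in> dom L"
      using IH True by (auto simp: r_def c_def n_def num_rows_def num_cols_def)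
    then obtain i where i: "i < r - 1" "(i, c) \<in> dom L" by blast
    define j where "j = pick (last t) {j. (r - 1, j) \<in> dom L}"
    have "{j. (r - 1, j) \<in> dom L} \<subseteq> {1..c}" using d by auto
    from pick_less[OF this card] have j: "j < c" "(r - 1, j) \<in> dom L" by (auto simp: j_def)
    have L': "ladder n t = L((r, j) \<mapsto> 2 * n + 3, (r, c) \<mapsto> 2 * n + 4)"
      using True by (simp add: n_def L_def r_def c_def j_def Let_def)
    have fresh: "(r, j) \<notin> dom L" "(r, c) \<notin> dom L" "(r, j) \<noteq> (r, c)" using d(1) j r by fastforce+
    note two = insert_two[OF inj fresh new, folded L']
    have dom: "dom (ladder n t) = insert (r, j) (insert (r, c) (dom L))"
      unfolding L' by auto
    have sub: "dom (ladder n t) \<subseteq> {1..r} \<times> {1..c}"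
      unfolding dom using d j r by fastforce
    then have "{i. (i, c) \<in> dom (ladder n t)} \<subseteq> {1..r}" by blast
    then have "finite {i. (i, c) \<in> dom (ladder n t)}" by (rule finite_subset) simp
    moreover have "{i, r - 1, r} \<subseteq> {i. (i, c) \<in> dom (ladder n t)}"
      unfolding dom using d i by blast
    ultimately have "card {i, r - 1, r} \<le> card {i. (i, c) \<in> dom (ladder n t)}"
      by (rule card_mono)
    then have "3 \<le> card {i. (i, c) \<in> dom (ladder n t)}" using i r by simp
    moreover have "(r, j) \<in> dom (ladder n t)" "(r, c) \<in> dom (ladder n t)" unfolding dom by blast+
    ultimately show ?thesis
      using True two(1) two(2)[unfolded ran'] sub j(1) ladder_inv_even[of n "ladder n t" j]
      unfolding r_def[symmetric] c_def[symmetric] by blast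
  next
    case False
    have d: "dom L \<subseteq> {1..r} \<times> {1..c - 1}" "(r, c - 1) \<in> dom L"
      and card: "card {i. (i, c - 1) \<in> dom L} \<ge> 3" and c: "c > 2"
      and "\<exists>j < c - 1. (r, j) \<in> dom L"
      using IH False by (auto simp: r_def c_def n_def num_rows_def num_cols_def)
    then obtain j where j: "j < c - 1" "(r, j) \<in> dom L" by blast
    define i where "i = pick (last t) {i. (i, c - 1) \<in> dom L}"
    have "{i. (i, c - 1) \<in> dom L} \<subseteq> {1..r}" using d by auto
    from pick_less[OF this card] have i: "i < r" "(i, c - 1) \<in> dom L" by (auto simp: i_def)
    have L': "ladder n t = L((i, c) \<mapsto> 2 * n + 3, (r, c) \<mapsto> 2 * n + 4)"
      using False by (simp add: n_def L_def r_def c_def i_def Let_def)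
    have fresh: "(i, c) \<notin> dom L" "(r, c) \<notin> dom L" "(i, c) \<noteq> (r, c)" using d(1) i c by fastforce+
    note two = insert_two[OF inj fresh new, folded L']
    have dom: "dom (ladder n t) = insert (i, c) (insert (r, c) (dom L))"
      unfolding L' by auto
    have sub: "dom (ladder n t) \<subseteq> {1..r} \<times> {1..c}"
      unfolding dom using d i c by fastforce
    then have "{j. (r, j) \<in> dom (ladder n t)} \<subseteq> {1..c}" by blast
    then have "finite {j. (r, j) \<in> dom (ladder n t)}" by (rule finite_subset) simp
    moreover have "{j, c - 1, c} \<subseteq> {j. (r, j) \<in> dom (ladder n t)}"
      unfolding dom using d j by blast
    ultimately have "card {j, c - 1, c} \<le> card {j. (r, j) \<in> dom (ladder n t)}"
      by (rule card_mono)
    then have "3 \<le> card {j. (r, j) \<in> dom (ladder n t)}" using j c by simp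
    moreover have "(i, c) \<in> dom (ladder n t)" "(r, c) \<in> dom (ladder n t)" unfolding dom by blast+
    ultimately show ?thesis
      using False two(1) two(2)[unfolded ran'] sub i(1) ladder_inv_odd[of n "ladder n t" i]
      unfolding r_def[symmetric] c_def[symmetric] by blast
  qed
  then show ?case by (simp only: n_def)
qed

lemma edges_bigraph: "edges (bigraph n t) = insert 0 {2..2 * n + 4}"
  using ladder_inv_ladder[of n t] by (simp add: bigraph_def ladder_inv_def)

lemma ends_bigraph:
  assumes "ladder n t (r, c) = Some e"
  shows "ends (bigraph n t) e = {Inl r, Inr c}"
proof -
  have "inj_on (ladder n t) (dom (ladder n t))"
    using ladder_inv_ladder[of n t] by (simp add: ladder_inv_def)
  then have "ladder n t (r', c') = Some e \<Longrightarrow> (r', c') = (r, c)" for r' c'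
    using assms by (metis domI inj_onD)
  then have "{{Inl r, Inr c} | r c. ladder n t (r, c) = Some e} = {{Inl r, Inr c}}"
    using assms by blast
  then show ?thesis by (simp add: bigraph_def)
qed

end

theory Submission
  imports Defs
begin

text \<open>
  Both dimensions are read off from prime ideals of the polynomial ring on the edges: chains of
  primes of \<open>R(n, t)\<close> are chains of primes containing the toric ideal, and chains of primes of the
  quotient by \<open>X_seq n\<close> are chains of primes containing the toric ideal and \<open>X_seq n\<close>
  (\<open>prime_chain_toric_ring\<close>, \<open>prime_chain_toric_quotient\<close>).

  The dimension of \<open>R(n, t)\<close> is the number of vertices minus one, here \<open>n + 3\<close>.  It is at most
  that because the toric ring lives inside the span of the monomials in the vertices that have
  equal degree on both sides of the bipartition: one exponent is determined by the others, so a
  count of monomials makes any \<open>n + 4\<close> elements algebraically dependent over the field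
  (\<open>toric_algebraic_dependence\<close>).  A strict chain of primes
  of length \<open>d\<close>, on the other hand, supplies \<open>d\<close> elements, one from each step of the chain, that
  satisfy no polynomial relation modulo the smallest prime
  (\<open>prime_chain_algebraically_independent\<close>).  This replaces transcendence degrees and the height
  theorem.  It is at least \<open>n + 3\<close> because the edges with even index form a path through all
  vertices: setting the vertices of the path to zero one after the other gives a chain of
  kernels of homomorphisms into a domain, and each step kills one further edge of the path
  (\<open>toric_prime_chain_exists\<close>, \<open>bigraph_path\<close>).

  For the quotient, each \<open>m \<le> n\<close> gives a \<open>2 \<times> 2\<close> minor of the ladder that lies in the toric
  ideal and has the form of a multiple of the variable numbered \<open>2m + 4\<close> minus the product of the
  variables numbered \<open>2m + 2\<close> and \<open>2m + 3\<close>.  Modulo \<open>X_seq n\<close> these two coincide, so a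
  prime containing the former variable contains both of the latter.  Starting from the last
  variable, which belongs to \<open>X_seq n\<close> as does the variable numbered \<open>0\<close>, and descending, such a
  prime contains all variables (\<open>variables_in_prime\<close>).  Hence the only prime above is the ideal of polynomials without
  constant term, and the quotient has dimension \<open>0\<close>.
\<close>

section \<open>Prime chains in quotient rings\<close>

text \<open>
  All quotients are described by chains of primes of the ring on top that contain a given set; this
  makes a quotient of a quotient no harder than a single one.
\<close>
definition prime_chain_above :: "('a, 'b) ring_scheme \<Rightarrow> 'a set \<Rightarrow> nat \<Rightarrow> bool" where
  "prime_chain_above R A d \<longleftrightarrow>
     (\<exists>P. (\<forall>i\<le>d. primeideal (P i) R \<and> A \<subseteq> P i) \<and> (\<forall>i<d. P i \<subset> P (Suc i)))"

lemma prime_chain_above_empty: "prime_chain_above R {} d \<longleftrightarrow> prime_chain R d"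
  by (simp add: prime_chain_above_def prime_chain_def)

lemma krull_dim_eqI:
  assumes "prime_chain R d" "\<And>d'. prime_chain R d' \<Longrightarrow> d' \<le> d"
  shows "krull_dim R = ereal (real d)"
  unfolding krull_dim_def by (rule Sup_eqI) (use assms in auto)

context ring_hom_ring
begin

lemma mem_image_ideal_iff:
  assumes P: "ideal P R" "a_kernel R S h \<subseteq> P" and x: "x \<in> carrier R"
  shows "h x \<in> h ` P \<longleftrightarrow> x \<in> P"
proof
  assume "h x \<in> h ` P"
  then obtain p where p: "p \<in> P" "h x = h p" by auto
  interpret P: ideal P R by fact
  have pc: "p \<in> carrier R" using p P.Icarr by auto
  have "h (x \<ominus> p) = h x \<ominus>\<^bsub>S\<^esub> h p"
    unfolding a_minus_def using x pc by (simp only: hom_add hom_a_inv R.a_inv_closed)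
  also have "\<dots> = \<zero>\<^bsub>S\<^esub>" unfolding a_minus_def p(2) using pc by (simp only: S.r_neg hom_closed)
  finally have "x \<ominus> p \<in> a_kernel R S h"
    unfolding a_kernel_def' using R.minus_closed[OF x pc] by blast
  then have "x \<ominus> p \<in> P" using P by blast
  then have "(x \<ominus> p) \<oplus> p \<in> P"
    by (rule additive_subgroup.a_closed[OF ideal.axioms(1)[OF assms(1)] _ p(1)])
  also have "(x \<ominus> p) \<oplus> p = x"
    unfolding a_minus_def using x pc
    by (simp only: R.a_assoc R.l_neg R.r_zero R.a_inv_closed)
  finally show "x \<in> P" .
qed auto

lemma primeideal_image:
  assumes surj: "h ` carrier R = carrier S" and S: "cring S"
    and P: "primeideal P R" "a_kernel R S h \<subseteq> P"
  shows "primeideal (h ` P) S"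
proof -
  interpret P: primeideal P R by fact
  note mem = mem_image_ideal_iff[OF P.is_ideal P(2)]
  show ?thesis
  proof (rule primeidealI[OF _ S])
    show "ideal (h ` P) S"
    proof (rule idealI)
      show "ring S" by (rule S.ring_axioms)
      show "subgroup (h ` P) (add_monoid S)"
        by (rule S.add.subgroupI)
          (auto simp flip: hom_add hom_a_inv, metis hom_zero P.zero_closed empty_iff)
      fix a x assume "a \<in> h ` P" "x \<in> carrier S"
      then obtain p y where py: "p \<in> P" "a = h p" "y \<in> carrier R" "x = h y" using surj by blast
      moreover have "h (y \<otimes> p) = h y \<otimes>\<^bsub>S\<^esub> h p" "h (p \<otimes> y) = h p \<otimes>\<^bsub>S\<^esub> h y"
        using py P.Icarr by (blast intro: hom_mult)+
      moreover have "h (y \<otimes> p) \<in> h ` P" "h (p \<otimes> y) \<in> h ` P"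
        using P.I_l_closed[OF py(1,3)] P.I_r_closed[OF py(1,3)] by blast+
      ultimately show "x \<otimes>\<^bsub>S\<^esub> a \<in> h ` P" "a \<otimes>\<^bsub>S\<^esub> x \<in> h ` P"
        by (simp_all only:)
    qed
    show "carrier S \<noteq> h ` P"
      using mem[of \<one>] P.I_notcarr P.one_imp_carrier by (metis R.one_closed imageI surj)
    fix a b assume ab: "a \<in> carrier S" "b \<in> carrier S" "a \<otimes>\<^bsub>S\<^esub> b \<in> h ` P"
    then obtain x y where xy: "x \<in> carrier R" "a = h x" "y \<in> carrier R" "b = h y"
      using surj by blast
    then have "x \<otimes> y \<in> P" using ab mem[of "x \<otimes> y"] by simp
    then show "a \<in> h ` P \<or> b \<in> h ` P" using P.I_prime xy by blast
  qed
qed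

text \<open>
  Taking preimages and images matches the primes of the target with the primes above the kernel,
  strictly preserving inclusion.
\<close>
lemma prime_chain_above_surj:
  assumes surj: "h ` carrier R = carrier S" and R: "cring R" and S: "cring S"
    and X: "X \<subseteq> carrier R"
  shows "prime_chain_above S (h ` X) d \<longleftrightarrow> prime_chain_above R (a_kernel R S h \<union> X) d"
proof
  assume "prime_chain_above S (h ` X) d"
  then obtain P where P: "\<And>i. i \<le> d \<Longrightarrow> primeideal (P i) S \<and> h ` X \<subseteq> P i"
    "\<And>i. i < d \<Longrightarrow> P i \<subset> P (Suc i)" unfolding prime_chain_above_def by blast
  define Q where "Q i = {r \<in> carrier R. h r \<in> P i}" for i
  have 1: "primeideal (Q i) R" if "i \<le> d" for i
    unfolding Q_def by (rule primeideal_vimage[OF R conjunct1[OF P(1)[OF that]]])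
  have 2: "a_kernel R S h \<union> X \<subseteq> Q i" if "i \<le> d" for i
  proof -
    have "ideal (P i) S" using P(1)[OF that] by (simp add: primeideal_def)
    then have zero: "\<zero>\<^bsub>S\<^esub> \<in> P i" by (intro additive_subgroup.zero_closed ideal.axioms(1))
    have "r \<in> Q i" if "r \<in> carrier R" "h r = \<zero>\<^bsub>S\<^esub>" for r
      unfolding Q_def using that(1) zero[folded that(2)] by blast
    then have "a_kernel R S h \<subseteq> Q i" unfolding a_kernel_def' by blast
    moreover have "X \<subseteq> Q i" unfolding Q_def using P(1)[OF that] X by blast
    ultimately show ?thesis by blast
  qed
  have 3: "Q i \<subset> Q (Suc i)" if i: "i < d" for i
  proof -
    have "ideal (P (Suc i)) S" using P(1)[of "Suc i"] i by (simp add: primeideal_def)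
    then have "P (Suc i) \<subseteq> carrier S" by (meson ideal.Icarr subsetI)
    moreover obtain s where s: "s \<in> P (Suc i)" "s \<notin> P i" using P(2)[OF i] by blast
    ultimately obtain r where "r \<in> carrier R" "s = h r" using surj by (metis imageE subsetD)
    with s have "r \<in> Q (Suc i)" "r \<notin> Q i" unfolding Q_def by blast+
    then show ?thesis using P(2)[OF i] unfolding Q_def by blast
  qed
  show "prime_chain_above R (a_kernel R S h \<union> X) d"
    unfolding prime_chain_above_def by (rule exI[of _ Q]) (use 1 2 3 in blast)
next
  assume "prime_chain_above R (a_kernel R S h \<union> X) d"
  then obtain P where P: "\<And>i. i \<le> d \<Longrightarrow> primeideal (P i) R \<and> a_kernel R S h \<union> X \<subseteq> P i"
    "\<And>i. i < d \<Longrightarrow> P i \<subset> P (Suc i)" unfolding prime_chain_above_def by blast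
  have "h ` P i \<subset> h ` P (Suc i)" if i: "i < d" for i
  proof -
    have "ideal (P i) R" "ideal (P (Suc i)) R"
      using P(1)[of i] P(1)[of "Suc i"] i by (auto simp: primeideal_def)
    moreover obtain r where r: "r \<in> P (Suc i)" "r \<notin> P i" using P(2)[OF i] by blast
    ultimately have "r \<in> carrier R" by (meson ideal.Icarr)
    then have "h r \<notin> h ` P i"
      using mem_image_ideal_iff[of "P i" r] P(1)[of i] r i by (auto simp: primeideal_def)
    then show ?thesis using P(2)[OF i] r by blast
  qed
  moreover have "primeideal (h ` P i) S \<and> h ` X \<subseteq> h ` P i" if "i \<le> d" for i
    using P(1)[OF that] primeideal_image[OF surj S] by blast
  ultimately show "prime_chain_above S (h ` X) d"
    unfolding prime_chain_above_def by (intro exI[of _ "\<lambda>i. h ` P i"]) blast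
qed

end

lemma (in cring) prime_chain_above_quot:
  assumes "ideal I R" and X: "X \<subseteq> carrier R"
  shows "prime_chain_above (R Quot I) ((+>) I ` X) d \<longleftrightarrow> prime_chain_above R (I \<union> X) d"
proof -
  interpret I: ideal I R by fact
  interpret h: ring_hom_ring R "R Quot I" "(+>) I" by (rule I.rcos_ring_hom_ring)
  have "I +> r = \<zero>\<^bsub>R Quot I\<^esub> \<longleftrightarrow> r \<in> I" if "r \<in> carrier R" for r
    using I.rcos_const_imp_mem[OF that] a_rcos_zero[OF assms(1), of r] by (auto simp only: FactRing_def ring.simps)
  then have "a_kernel R (R Quot I) ((+>) I) = I"
    unfolding a_kernel_def' using I.Icarr by blast
  moreover have "(+>) I ` carrier R = carrier (R Quot I)"
    unfolding FactRing_simps by auto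
  ultimately show ?thesis
    using h.prime_chain_above_surj[OF _ cring_axioms I.quotient_is_cring[OF cring_axioms] X, of d]
    by (simp only: simp_thms)
qed

text \<open>
  A prime contains the ideal generated by a set as soon as it contains the set, so the two
  quotients only add up the conditions on the primes.
\<close>
lemma (in cring) prime_chain_quot_quot:
  assumes "ideal I R" and X: "X \<subseteq> carrier R"
  shows "prime_chain (R Quot I Quot Idl\<^bsub>R Quot I\<^esub> ((+>) I ` X)) d \<longleftrightarrow> prime_chain_above R (I \<union> X) d"
proof -
  interpret I: ideal I R by fact
  interpret Q: cring "R Quot I" by (rule I.quotient_is_cring[OF cring_axioms])
  let ?X = "(+>) I ` X"
  have X': "?X \<subseteq> carrier (R Quot I)" using X by (auto simp: FactRing_simps)
  have "Idl\<^bsub>R Quot I\<^esub> ?X \<subseteq> P \<longleftrightarrow> ?X \<subseteq> P" if "primeideal P (R Quot I)" for P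
    using that Q.genideal_self[OF X'] Q.genideal_minimal[of P ?X] by (auto simp: primeideal_def)
  then have "prime_chain_above (R Quot I) (Idl\<^bsub>R Quot I\<^esub> ?X) d \<longleftrightarrow> prime_chain_above (R Quot I) ?X d"
    unfolding prime_chain_above_def by (metis (no_types, lifting))
  then show ?thesis
    using Q.prime_chain_above_quot[OF Q.genideal_ideal[OF X'], of "{}" d] prime_chain_above_quot[OF assms, of d]
    by (simp add: prime_chain_above_empty)
qed

section \<open>Polynomial rings and substitution\<close>

lemma mconst_simps [simp]:
  "mconst 0 = (0 :: ('x, 'k::comm_ring_1) mpoly)"
  "mconst 1 = (1 :: ('x, 'k::comm_ring_1) mpoly)"
  "mconst (a + b) = (mconst a + mconst b :: ('x, 'k::comm_ring_1) mpoly)"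
  "mconst (a * b) = (mconst a * mconst b :: ('x, 'k::comm_ring_1) mpoly)"
  by (simp_all add: mconst_def single_add mult_single)

lemma lookup_mconst_mult: "Poly_Mapping.lookup (mconst c * p) m = c * Poly_Mapping.lookup p m"
  by (simp add: mconst_def flip: mult_map_scale_conv_mult)
     (simp add: Poly_Mapping.map.rep_eq when_def)

lemma poly_mapping_sum_single:
  "p = (\<Sum>m \<in> Poly_Mapping.keys p. Poly_Mapping.single m (Poly_Mapping.lookup p m))"
  by (rule poly_mapping_eqI)
    (auto simp: lookup_sum lookup_single when_def in_keys_iff sum.delta' sum.delta)

lemma poly_ring_simps [simp]:
  "mult (poly_ring X) = (*)" "one (poly_ring X) = 1" "zero (poly_ring X) = 0" "add (poly_ring X) = (+)"
  by (simp_all add: poly_ring_def)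

lemma poly_ring_carrier:
  "p \<in> carrier (poly_ring X) \<longleftrightarrow> (\<forall>m \<in> Poly_Mapping.keys p. Poly_Mapping.keys m \<subseteq> X)"
  by (simp add: poly_ring_def)

lemma poly_ring_UNIV [simp]: "carrier (poly_ring UNIV) = UNIV"
  by (auto simp: poly_ring_carrier)

lemma poly_ring_closed:
  fixes p q :: "('x, 'k::comm_ring_1) mpoly"
  shows "mconst c \<in> carrier (poly_ring X)"
    "x \<in> X \<Longrightarrow> (mvar x :: ('x, 'k) mpoly) \<in> carrier (poly_ring X)"
    "p \<in> carrier (poly_ring X) \<Longrightarrow> q \<in> carrier (poly_ring X) \<Longrightarrow> p + q \<in> carrier (poly_ring X)"
    "p \<in> carrier (poly_ring X) \<Longrightarrow> q \<in> carrier (poly_ring X) \<Longrightarrow> p * q \<in> carrier (poly_ring X)"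
    "p \<in> carrier (poly_ring X) \<Longrightarrow> - p \<in> carrier (poly_ring X)"
proof -
  show "mconst c \<in> carrier (poly_ring X)" by (simp add: mconst_def poly_ring_carrier)
  show "(mvar x :: ('x, 'k) mpoly) \<in> carrier (poly_ring X)" if "x \<in> X"
    using that by (simp add: mvar_def poly_ring_carrier)
  assume p: "p \<in> carrier (poly_ring X)"
  show "- p \<in> carrier (poly_ring X)" using p by (auto simp: poly_ring_carrier in_keys_iff)
  assume q: "q \<in> carrier (poly_ring X)"
  show "p + q \<in> carrier (poly_ring X)"
    using p q keys_add[of p q] by (auto simp: poly_ring_carrier dest!: subsetD)
  show "p * q \<in> carrier (poly_ring X)"
    unfolding poly_ring_carrier
  proof
    fix m assume "m \<in> Poly_Mapping.keys (p * q)"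
    then obtain a b where ab: "m = a + b" "a \<in> Poly_Mapping.keys p" "b \<in> Poly_Mapping.keys q"
      using keys_mult[of p q] by blast
    then show "Poly_Mapping.keys m \<subseteq> X"
      using p q keys_add[of a b] by (auto simp: poly_ring_carrier dest!: subsetD)
  qed
qed

lemma poly_ring_closed_zero_one:
  "0 \<in> carrier (poly_ring X)" "1 \<in> carrier (poly_ring X)"
  using poly_ring_closed(1)[of 0 X] poly_ring_closed(1)[of 1 X] by simp_all

lemma poly_ring_closed_diff:
  "p \<in> carrier (poly_ring X) \<Longrightarrow> q \<in> carrier (poly_ring X) \<Longrightarrow> p - q \<in> carrier (poly_ring X)"
  using poly_ring_closed(3)[of p X "- q"] poly_ring_closed(5)[of q X] by simp

lemma poly_ring_closed_sum:
  "(\<And>i. i \<in> A \<Longrightarrow> p i \<in> carrier (poly_ring X)) \<Longrightarrow> sum p A \<in> carrier (poly_ring X)"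
  by (induction A rule: infinite_finite_induct) (auto simp: poly_ring_closed poly_ring_closed_zero_one)

lemma poly_ring_closed_prod:
  "(\<And>i. i \<in> A \<Longrightarrow> p i \<in> carrier (poly_ring X)) \<Longrightarrow> prod p A \<in> carrier (poly_ring X)"
  by (induction A rule: infinite_finite_induct) (auto simp: poly_ring_closed poly_ring_closed_zero_one)

lemma poly_ring_closed_power:
  "p \<in> carrier (poly_ring X) \<Longrightarrow> p ^ i \<in> carrier (poly_ring X)"
  by (induction i) (auto simp: poly_ring_closed poly_ring_closed_zero_one)

lemma cring_poly_ring: "cring (poly_ring X)"
proof (rule cringI)
  show "abelian_group (poly_ring X)"
  proof (rule abelian_groupI)
    fix x assume "x \<in> carrier (poly_ring X)"
    then show "\<exists>y\<in>carrier (poly_ring X). y \<oplus>\<^bsub>poly_ring X\<^esub> x = \<zero>\<^bsub>poly_ring X\<^esub>"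
      by (intro bexI[of _ "- x"]) (simp_all add: poly_ring_closed)
  qed (simp_all add: poly_ring_closed poly_ring_closed_zero_one ac_simps)
  show "comm_monoid (poly_ring X)"
    by (rule comm_monoidI) (auto simp: poly_ring_closed poly_ring_closed_zero_one mult_ac)
qed (simp add: algebra_simps)

text \<open>
  The properties of primes in terms of the arithmetic on the type of polynomials instead of the
  record operations, so that ordinary sums and products can be used below.
\<close>
lemma primeideal_poly_ring:
  assumes "primeideal P (poly_ring X)"
  shows "P \<subseteq> carrier (poly_ring X)" "0 \<in> P"
    "p \<in> P \<Longrightarrow> q \<in> P \<Longrightarrow> p + q \<in> P"
    "p \<in> P \<Longrightarrow> q \<in> P \<Longrightarrow> p - q \<in> P"
    "p \<in> P \<Longrightarrow> r \<in> carrier (poly_ring X) \<Longrightarrow> r * p \<in> P"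
    "p \<in> carrier (poly_ring X) \<Longrightarrow> q \<in> carrier (poly_ring X) \<Longrightarrow> p * q \<in> P \<Longrightarrow> p \<in> P \<or> q \<in> P"
    "1 \<notin> P"
proof -
  interpret P: primeideal P "poly_ring X" by fact
  note sg = ideal.axioms(1)[OF P.is_ideal]
  show sub: "P \<subseteq> carrier (poly_ring X)" using P.Icarr by blast
  show "0 \<in> P" using additive_subgroup.zero_closed[OF sg] by simp
  show add: "p + q \<in> P" if "p \<in> P" "q \<in> P" for p q using additive_subgroup.a_closed[OF sg that] by simp
  show mult: "r * p \<in> P" if "p \<in> P" "r \<in> carrier (poly_ring X)" for p r
    using P.I_l_closed[OF that] by simp
  show "p - q \<in> P" if "p \<in> P" "q \<in> P"
    using add[OF that(1) mult[OF that(2) poly_ring_closed(5)[OF poly_ring_closed_zero_one(2)]]] by simp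
  show "p \<in> P \<or> q \<in> P" if "p \<in> carrier (poly_ring X)" "q \<in> carrier (poly_ring X)" "p * q \<in> P"
    using P.I_prime[OF that(1,2)] that(3) by simp
  show "1 \<notin> P" using P.one_imp_carrier P.I_notcarr by auto
qed

definition subst_monom :: "('x \<Rightarrow> ('y, 'k::comm_ring_1) mpoly) \<Rightarrow> ('x \<Rightarrow>\<^sub>0 nat) \<Rightarrow> ('y, 'k) mpoly" where
  "subst_monom f m = (\<Prod>x \<in> Poly_Mapping.keys m. f x ^ Poly_Mapping.lookup m x)"

lemma subst_monom_superset:
  assumes "finite K" "Poly_Mapping.keys m \<subseteq> K"
  shows "subst_monom f m = (\<Prod>x \<in> K. f x ^ Poly_Mapping.lookup m x)"
  unfolding subst_monom_def by (rule prod.mono_neutral_left) (use assms in \<open>auto simp: in_keys_iff\<close>)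

lemma subst_monom_0 [simp]: "subst_monom f 0 = 1"
  by (simp add: subst_monom_def)

lemma subst_monom_add: "subst_monom f (a + b) = subst_monom f a * subst_monom f b"
proof -
  let ?K = "Poly_Mapping.keys a \<union> Poly_Mapping.keys b"
  have "subst_monom f (a + b) = (\<Prod>x \<in> ?K. f x ^ Poly_Mapping.lookup (a + b) x)"
    using keys_add[of a b] by (intro subst_monom_superset) auto
  also have "\<dots> = (\<Prod>x \<in> ?K. f x ^ Poly_Mapping.lookup a x) * (\<Prod>x \<in> ?K. f x ^ Poly_Mapping.lookup b x)"
    by (simp add: lookup_add power_add prod.distrib)
  finally show ?thesis by (simp flip: subst_monom_superset)
qed

text \<open>
  Allowing any finite index set that covers the support makes \<open>poly_hom\<close> visibly additive, since
  two polynomials can then be summed over the same set.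
\<close>
lemma poly_hom_superset:
  assumes "finite K" "Poly_Mapping.keys p \<subseteq> K"
  shows "poly_hom f p = (\<Sum>m \<in> K. mconst (Poly_Mapping.lookup p m) * subst_monom f m)"
  unfolding poly_hom_def subst_monom_def
  by (rule sum.mono_neutral_left) (use assms in \<open>auto simp: in_keys_iff\<close>)

lemma poly_hom_0 [simp]: "poly_hom f 0 = 0"
  by (simp add: poly_hom_def)

lemma poly_hom_add: "poly_hom f (p + q) = poly_hom f p + poly_hom f q"
proof -
  let ?K = "Poly_Mapping.keys p \<union> Poly_Mapping.keys q"
  show ?thesis
    using poly_hom_superset[of ?K "p + q" f] poly_hom_superset[of ?K p f] poly_hom_superset[of ?K q f]
      keys_add[of p q]
    by (simp add: lookup_add sum.distrib algebra_simps)
qed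

lemma poly_hom_sum: "poly_hom f (sum p A) = (\<Sum>i \<in> A. poly_hom f (p i))"
  by (induction A rule: infinite_finite_induct) (auto simp: poly_hom_add)

lemma poly_hom_single: "poly_hom f (Poly_Mapping.single m c) = mconst c * subst_monom f m"
  by (subst poly_hom_superset[of "{m}"]) auto

lemma poly_hom_mconst [simp]: "poly_hom f (mconst c) = mconst c"
  by (metis mconst_def mult_1_right poly_hom_single subst_monom_0)

lemma poly_hom_1 [simp]: "poly_hom f 1 = 1"
  using poly_hom_mconst[of f 1] by simp

lemma poly_hom_mvar [simp]: "poly_hom f (mvar x) = f x"
  by (simp add: mvar_def poly_hom_single subst_monom_def)

lemma poly_hom_mult: "poly_hom f (p * q) = poly_hom f p * poly_hom f q"
proof -
  have single: "poly_hom f (Poly_Mapping.single a c * Poly_Mapping.single b d)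
      = poly_hom f (Poly_Mapping.single a c) * poly_hom f (Poly_Mapping.single b d)" for a b c d
    by (simp add: mult_single poly_hom_single subst_monom_add mult_ac)
  define P where "P m = Poly_Mapping.single m (Poly_Mapping.lookup p m)" for m
  define Q where "Q m = Poly_Mapping.single m (Poly_Mapping.lookup q m)" for m
  have pq: "p = sum P (Poly_Mapping.keys p)" "q = sum Q (Poly_Mapping.keys q)"
    unfolding P_def Q_def by (rule poly_mapping_sum_single)+
  have "poly_hom f (sum P A * sum Q B) = poly_hom f (sum P A) * poly_hom f (sum Q B)" for A B
    by (simp only: sum_product poly_hom_sum P_def Q_def single)
  then show ?thesis by (metis pq)
qed

lemma poly_hom_uminus: "poly_hom f (- p) = - poly_hom f p"
  using poly_hom_add[of f p "- p"] by (simp add: eq_neg_iff_add_eq_0 add.commute)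

lemma poly_hom_diff: "poly_hom f (p - q) = poly_hom f p - poly_hom f q"
  using poly_hom_add[of f p "- q"] by (simp add: poly_hom_uminus)

lemma poly_hom_prod: "poly_hom f (prod p A) = (\<Prod>i \<in> A. poly_hom f (p i))"
  by (induction A rule: infinite_finite_induct) (auto simp: poly_hom_mult)

lemma poly_hom_power: "poly_hom f (p ^ i) = poly_hom f p ^ i"
  by (induction i) (auto simp: poly_hom_mult)

lemma poly_hom_poly_hom: "poly_hom g (poly_hom f p) = poly_hom (\<lambda>x. poly_hom g (f x)) p"
  unfolding poly_hom_def[of f p] poly_hom_def[of _ p]
  by (simp only: poly_hom_sum poly_hom_mult poly_hom_prod poly_hom_power poly_hom_mconst)

lemma poly_hom_closed:
  assumes "f ` X \<subseteq> carrier (poly_ring Y)" "p \<in> carrier (poly_ring X)"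
  shows "poly_hom f p \<in> carrier (poly_ring Y)"
  unfolding poly_hom_def
  by (intro poly_ring_closed_sum poly_ring_closed poly_ring_closed_prod poly_ring_closed_power)
    (use assms in \<open>auto simp: poly_ring_carrier[of p]\<close>)

lemma poly_hom_cong:
  assumes "p \<in> carrier (poly_ring X)" "\<And>x. x \<in> X \<Longrightarrow> f x = g x"
  shows "poly_hom f p = poly_hom g p"
  unfolding poly_hom_def
  by (intro sum.cong prod.cong arg_cong2[where f = "(*)"] arg_cong2[where f = "(^)"] refl)
    (use assms in \<open>auto simp: poly_ring_carrier\<close>)

lemma ring_hom_poly_hom:
  assumes "f ` X \<subseteq> carrier (poly_ring Y)"
  shows "ring_hom_ring (poly_ring X) (poly_ring Y) (poly_hom f)"
proof (rule ring_hom_ringI)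
  show "ring (poly_ring X)" "ring (poly_ring Y)" using cring_poly_ring cring.axioms(1) by blast+
qed (use poly_hom_closed[OF assms] in \<open>simp_all add: poly_hom_add poly_hom_mult\<close>)

definition subst_kernel :: "'x set \<Rightarrow> ('x \<Rightarrow> ('y, 'k::comm_ring_1) mpoly) \<Rightarrow> ('x, 'k) mpoly set" where
  "subst_kernel X f = {p \<in> carrier (poly_ring X). poly_hom f p = 0}"

text \<open>
  The linear order on the target variables makes their polynomial ring an integral domain, by
  comparison of leading monomials.
\<close>
lemma primeideal_subst_kernel:
  fixes f :: "'x \<Rightarrow> ('y::linorder, 'k::field) mpoly"
  shows "primeideal (subst_kernel X f) (poly_ring X)"
proof (rule primeidealI[OF _ cring_poly_ring])
  have "subst_kernel X f = a_kernel (poly_ring X) (poly_ring UNIV) (poly_hom f)"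
    by (simp add: a_kernel_def' subst_kernel_def)
  then show "ideal (subst_kernel X f) (poly_ring X)"
    using ring_hom_ring.kernel_is_ideal[OF ring_hom_poly_hom[of f X UNIV]] by simp
  have "1 \<in> carrier (poly_ring X) - subst_kernel X f"
    using poly_ring_closed_zero_one(2)[of X] by (simp add: subst_kernel_def)
  then show "carrier (poly_ring X) \<noteq> subst_kernel X f" by blast
next
  fix p q assume "p \<in> carrier (poly_ring X)" "q \<in> carrier (poly_ring X)"
    "p \<otimes>\<^bsub>poly_ring X\<^esub> q \<in> subst_kernel X f"
  then show "p \<in> subst_kernel X f \<or> q \<in> subst_kernel X f"
    by (simp add: subst_kernel_def poly_hom_mult)
qed

section \<open>Chains of primes and polynomial relations\<close>

text \<open>
  Words of length \<open>k\<close> over \<open>{..<M}\<close> serve as exponent vectors of monomials in a list of \<open>k\<close>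
  elements; recursion on lists then peels off one variable at a time.
\<close>
definition words :: "nat \<Rightarrow> nat \<Rightarrow> nat list set" where
  "words M k = {a. length a = k \<and> set a \<subseteq> {..<M}}"

definition power_word :: "'a::comm_monoid_mult list \<Rightarrow> nat list \<Rightarrow> 'a" where
  "power_word xs a = prod_list (map2 (^) xs a)"

lemma power_word_simps [simp]:
  "power_word [] a = 1" "power_word (x # xs) (m # a) = x ^ m * power_word xs a"
  by (simp_all add: power_word_def)

lemma words_0: "words M 0 = {[]}"
  by (auto simp: words_def)

lemma words_Suc: "words M (Suc k) = (\<lambda>(m, a). m # a) ` ({..<M} \<times> words M k)"
  by (auto simp: words_def length_Suc_conv image_iff)

lemma finite_words: "finite (words M k)"
  by (induction k) (simp_all add: words_0 words_Suc)

lemma card_words: "card (words M k) = M ^ k"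
  using card_lists_length_eq[of "{..<M}" k] by (simp add: words_def conj_commute)

lemma sum_words_Suc: "sum g (words M (Suc k)) = (\<Sum>m<M. \<Sum>a\<in>words M k. g (m # a))"
  unfolding words_Suc
  by (subst sum.reindex) (auto simp: inj_on_def sum.cartesian_product case_prod_beta)

lemma power_word_closed:
  "set xs \<subseteq> carrier (poly_ring X) \<Longrightarrow> power_word xs a \<in> carrier (poly_ring X)"
  unfolding power_word_def
  by (induction xs a rule: list_induct2')
    (auto simp: poly_ring_closed poly_ring_closed_zero_one poly_ring_closed_power)

text \<open>
  Consider a relation modulo the smallest prime and its lexicographically least monomial.  The first
  element \<open>x\<close> lies outside \<open>P 0\<close>, so the least power of \<open>x\<close> that occurs can be cancelled; and \<open>x\<close>
  lies in \<open>P 1\<close>, so all terms with a higher power of \<open>x\<close> disappear modulo \<open>P 1\<close>.  What remains is a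
  relation between the other elements along the rest of the chain, and in the end a single constant
  in a prime ideal.
\<close>
lemma prime_chain_algebraically_independent:
  fixes c :: "nat list \<Rightarrow> 'k::field" and xs :: "('x, 'k) mpoly list"
  assumes "\<And>i. i \<le> length xs \<Longrightarrow> primeideal (P i) (poly_ring X)"
    and "\<And>i. i < length xs \<Longrightarrow> P i \<subseteq> P (Suc i)"
    and "\<And>i. i < length xs \<Longrightarrow> xs ! i \<in> P (Suc i) - P i"
    and "(\<Sum>a\<in>words M (length xs). mconst (c a) * power_word xs a) \<in> P 0"
    and "a \<in> words M (length xs)"
  shows "c a = 0"
  using assms
proof (induction xs arbitrary: P c a)
  case Nil
  note P0 = primeideal_poly_ring[OF Nil(1)[of 0, simplified]]
  have "mconst (c []) \<in> P 0" using Nil(4) by (simp add: words_0)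
  then have "mconst (1 / c []) * mconst (c []) \<in> P 0" by (intro P0(5) poly_ring_closed)
  then have "mconst (1 / c [] * c []) \<in> P 0" by (simp only: mconst_simps)
  then show ?case using Nil(5) P0(7) by (cases "c [] = 0") (simp_all add: words_0)
next
  case (Cons x xs)
  note P0 = primeideal_poly_ring[OF Cons.prems(1)[of 0, simplified]]
  note P1 = primeideal_poly_ring[OF Cons.prems(1)[of "Suc 0", simplified]]
  have x: "x \<in> P 1" "x \<notin> P 0" using Cons.prems(3)[of 0] by simp_all
  have xc: "x \<in> carrier (poly_ring X)" using x(1) P1(1) by auto
  have xsc: "set xs \<subseteq> carrier (poly_ring X)"
  proof
    fix y assume "y \<in> set xs"
    then obtain i where i: "i < length xs" "y = xs ! i" by (metis in_set_conv_nth)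
    then have "y \<in> P (Suc (Suc i))" using Cons.prems(3)[of "Suc i"] by simp
    then show "y \<in> carrier (poly_ring X)"
      using primeideal_poly_ring(1)[OF Cons.prems(1)[of "Suc (Suc i)"]] i by auto
  qed
  \<comment> \<open>The coefficient of \<open>x ^ m\<close> in the relation, a polynomial in the other elements.\<close>
  define T where "T m = (\<Sum>b\<in>words M (length xs). mconst (c (m # b)) * power_word xs b)" for m
  have T: "T m \<in> carrier (poly_ring X)" for m
    unfolding T_def by (intro poly_ring_closed_sum poly_ring_closed power_word_closed xsc)
  have sum: "(\<Sum>m<M. x ^ m * T m) \<in> P 0"
    using Cons.prems(4) by (simp add: sum_words_Suc T_def sum_distrib_left mult_ac)
  have xm: "x ^ m \<notin> P 0" for m
  proof (induction m)
    case (Suc m)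
    then show ?case using P0(6)[of x "x ^ m"] x xc poly_ring_closed_power[OF xc, of m] by auto
  qed (use P0(7) in simp)
  have *: "\<forall>b\<in>words M (length xs). c (m # b) = 0" if "m < M" for m
    using that
  proof (induction m rule: less_induct)
    case (less m)
    \<comment> \<open>The terms after the one with \<open>x ^ m\<close>, divided by \<open>x ^ Suc m\<close>.\<close>
    define U where "U = (\<Sum>i\<in>{Suc m..<M}. x ^ (i - Suc m) * T i)"
    have U: "U \<in> carrier (poly_ring X)"
      unfolding U_def by (intro poly_ring_closed_sum poly_ring_closed poly_ring_closed_power xc T)
    have "(\<Sum>i<M. x ^ i * T i) = (\<Sum>i\<in>insert m {Suc m..<M}. x ^ i * T i)"
    proof (rule sum.mono_neutral_right)
      have "T i = 0" if "i < m" for i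
        using less.IH[OF that] less.prems that by (simp add: T_def)
      moreover have "{..<M} - insert m {Suc m..<M} = {..<m}" using less.prems by auto
      ultimately show "\<forall>i\<in>{..<M} - insert m {Suc m..<M}. x ^ i * T i = 0" by simp
    qed (use less in auto)
    also have "\<dots> = x ^ m * T m + (\<Sum>i\<in>{Suc m..<M}. x ^ i * T i)" by simp
    also have "(\<Sum>i\<in>{Suc m..<M}. x ^ i * T i) = (\<Sum>i\<in>{Suc m..<M}. x ^ m * (x * (x ^ (i - Suc m) * T i)))"
    proof (rule sum.cong)
      fix i assume "i \<in> {Suc m..<M}"
      then have "x ^ i = x ^ m * (x * x ^ (i - Suc m))"
        by (simp flip: power_Suc power_add)
      then show "x ^ i * T i = x ^ m * (x * (x ^ (i - Suc m) * T i))" by (simp add: mult_ac)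
    qed simp
    also have "x ^ m * T m + \<dots> = x ^ m * (T m + x * U)"
      by (simp add: U_def sum_distrib_left algebra_simps)
    finally have "x ^ m * (T m + x * U) \<in> P 0" using sum by simp
    then have "T m + x * U \<in> P 0"
      using P0(6)[of "x ^ m" "T m + x * U"] xm[of m] T[of m] U xc
        poly_ring_closed_power[OF xc, of m] poly_ring_closed(3,4) by metis
    then have "T m + x * U \<in> P 1" using Cons.prems(2)[of 0] by auto
    moreover have "U * x \<in> P 1" using P1(5)[OF _ U] x(1) by simp
    moreover have "T m + x * U - U * x = T m" by (simp add: mult.commute)
    ultimately have "T m \<in> P 1" using P1(4) by (metis One_nat_def)
    show ?case
    proof
      fix b assume "b \<in> words M (length xs)"
      then show "c (m # b) = 0"
      proof (rule Cons.IH[of "\<lambda>i. P (Suc i)" "\<lambda>b. c (m # b)", rotated 4])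
        show "(\<Sum>b\<in>words M (length xs). mconst (c (m # b)) * power_word xs b) \<in> P (Suc 0)"
          using \<open>T m \<in> P 1\<close> by (simp add: T_def)
        show "primeideal (P (Suc i)) (poly_ring X)" if "i \<le> length xs" for i
          using that Cons.prems(1)[of "Suc i"] by simp
        show "P (Suc i) \<subseteq> P (Suc (Suc i))" if "i < length xs" for i
          using that Cons.prems(2)[of "Suc i"] by simp
        show "xs ! i \<in> P (Suc (Suc i)) - P (Suc i)" if "i < length xs" for i
          using that Cons.prems(3)[of "Suc i"] by simp
      qed
    qed
  qed
  show ?case using Cons.prems(5) * by (auto simp: words_Suc)
qed

text \<open>
  Gaussian elimination: an equation \<open>b\<close> in which the unknown \<open>a0\<close> occurs is used to eliminate \<open>a0\<close>
  from all other equations.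
\<close>
lemma underdetermined_linear_system:
  fixes f :: "'a \<Rightarrow> 'b \<Rightarrow> 'k::field"
  assumes "finite B" "finite A" "card B < card A"
  shows "\<exists>c. (\<exists>a\<in>A. c a \<noteq> 0) \<and> (\<forall>b\<in>B. (\<Sum>a\<in>A. c a * f a b) = 0)"
  using assms
proof (induction B arbitrary: A f rule: finite_induct)
  case empty
  then show ?case by (intro exI[of _ "\<lambda>_. 1"]) (auto simp: card_gt_0_iff)
next
  case (insert b B)
  show ?case
  proof (cases "\<forall>a\<in>A. f a b = 0")
    case True
    have "card B < card A" using insert by simp
    then obtain c where "\<exists>a\<in>A. c a \<noteq> 0" "\<forall>b\<in>B. (\<Sum>a\<in>A. c a * f a b) = 0"
      using insert by metis
    then show ?thesis using True by (intro exI[of _ c]) simp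
  next
    case False
    then obtain a0 where a0: "a0 \<in> A" "f a0 b \<noteq> 0" by blast
    \<comment> \<open>The coefficients after the substitution for the unknown \<open>a0\<close>.\<close>
    define f' where "f' a b' = f a b' - f a b / f a0 b * f a0 b'" for a b'
    have "card B < card (A - {a0})" using insert a0 by simp
    then obtain c where c: "\<exists>a\<in>A - {a0}. c a \<noteq> 0" "\<forall>b\<in>B. (\<Sum>a\<in>A - {a0}. c a * f' a b) = 0"
      using insert.IH[of "A - {a0}" f'] insert.prems by auto
    define s where "s = (\<Sum>a\<in>A - {a0}. c a * f a b) / f a0 b"
    define c' where "c' a = (if a = a0 then - s else c a)" for a
    have eq: "(\<Sum>a\<in>A. c' a * f a b') = (\<Sum>a\<in>A - {a0}. c a * f' a b')" for b'
    proof -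
      have "(\<Sum>a\<in>A. c' a * f a b') = - s * f a0 b' + (\<Sum>a\<in>A - {a0}. c a * f a b')"
        using insert.prems a0 by (subst sum.remove[of A a0]) (auto simp: c'_def intro!: sum.cong)
      also have "\<dots> = (\<Sum>a\<in>A - {a0}. c a * f' a b')"
        by (simp add: s_def f'_def sum_divide_distrib sum_distrib_left sum_subtractf algebra_simps)
      finally show ?thesis .
    qed
    have "(\<Sum>a\<in>A. c' a * f a b') = 0" if "b' \<in> insert b B" for b'
      using that c(2) a0(2) unfolding eq by (auto simp: f'_def)
    moreover have "\<exists>a\<in>A. c' a \<noteq> 0" using c(1) by (auto simp: c'_def)
    ultimately show ?thesis by blast
  qed
qed

section \<open>The dimension of a bipartite toric ring is less than the number of vertices\<close>

text \<open>
  Every edge contributes one vertex to each side of the bipartition \<open>U\<close>, \<open>V\<close>, so these are the only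
  exponent vectors that occur in the image of the toric homomorphism.
\<close>
definition balanced :: "'v set \<Rightarrow> 'v set \<Rightarrow> ('v \<Rightarrow>\<^sub>0 nat) set" where
  "balanced U V = {m. Poly_Mapping.keys m \<subseteq> U \<union> V \<and>
     (\<Sum>u\<in>U. Poly_Mapping.lookup m u) = (\<Sum>v\<in>V. Poly_Mapping.lookup m v)}"

definition exps_le :: "nat \<Rightarrow> ('v \<Rightarrow>\<^sub>0 nat) set" where
  "exps_le D = {m. \<forall>v. Poly_Mapping.lookup m v \<le> D}"

lemma balanced_0: "0 \<in> balanced U V"
  by (simp add: balanced_def)

lemma balanced_add: "a \<in> balanced U V \<Longrightarrow> b \<in> balanced U V \<Longrightarrow> a + b \<in> balanced U V"
  using keys_add[of a b] by (auto simp: balanced_def lookup_add sum.distrib)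

lemma exps_le_add: "a \<in> exps_le D \<Longrightarrow> b \<in> exps_le E \<Longrightarrow> a + b \<in> exps_le (D + E)"
  by (auto simp: exps_le_def lookup_add add_mono)

lemma exps_le_mono: "D \<le> E \<Longrightarrow> exps_le D \<subseteq> exps_le E"
  by (auto simp: exps_le_def intro: order_trans)

text \<open>
  The exponent of any chosen vertex \<open>u\<close> is determined by the others through the balance, which saves
  one factor \<open>D + 1\<close>.
\<close>
lemma card_balanced:
  assumes "finite U" "finite V" "U \<inter> V = {}" "U \<noteq> {}"
  shows "finite (balanced U V \<inter> exps_le D)"
    "card (balanced U V \<inter> exps_le D) \<le> (D + 1) ^ (card U + card V - 1)"
proof -
  obtain u where u: "u \<in> U" using assms by blast
  define W where "W = U \<union> V - {u}"
  have cW: "finite W" "card W = card U + card V - 1"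
    using assms u by (auto simp: W_def card_Un_disjoint)
  define F where "F m = restrict (Poly_Mapping.lookup m) W" for m :: "'a \<Rightarrow>\<^sub>0 nat"
  have inj: "inj_on F (balanced U V \<inter> exps_le D)"
  proof (rule inj_onI, elim IntE)
    fix a b assume a: "a \<in> balanced U V" and b: "b \<in> balanced U V" and eq: "F a = F b"
    have W: "Poly_Mapping.lookup a v = Poly_Mapping.lookup b v" if "v \<in> W" for v
      using fun_cong[OF eq, of v] that by (simp add: F_def)
    have split: "(\<Sum>v\<in>U. Poly_Mapping.lookup m v) = Poly_Mapping.lookup m u + (\<Sum>v\<in>U - {u}. Poly_Mapping.lookup m v)"
      for m :: "'a \<Rightarrow>\<^sub>0 nat"
      using assms u by (simp add: sum.remove)
    have "(\<Sum>v\<in>V. Poly_Mapping.lookup a v) = (\<Sum>v\<in>V. Poly_Mapping.lookup b v)"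
      "(\<Sum>v\<in>U - {u}. Poly_Mapping.lookup a v) = (\<Sum>v\<in>U - {u}. Poly_Mapping.lookup b v)"
      using W u assms(3) by (auto intro!: sum.cong simp: W_def)
    then have u_eq: "Poly_Mapping.lookup a u = Poly_Mapping.lookup b u"
      using a b by (simp add: balanced_def split)
    show "a = b"
    proof (rule poly_mapping_eqI)
      fix v
      show "Poly_Mapping.lookup a v = Poly_Mapping.lookup b v"
      proof (cases "v \<in> U \<union> V")
        case True
        then show ?thesis using W u_eq by (cases "v = u") (auto simp: W_def)
      next
        case False
        then have "v \<notin> Poly_Mapping.keys a" "v \<notin> Poly_Mapping.keys b"
          using a b by (auto simp: balanced_def)
        then show ?thesis by (simp add: in_keys_iff)
      qed
    qed
  qed
  have sub: "F ` (balanced U V \<inter> exps_le D) \<subseteq> PiE W (\<lambda>_. {..D})"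
    by (auto simp: F_def exps_le_def)
  have fin: "finite (PiE W (\<lambda>_. {..D}))" using cW by (intro finite_PiE) auto
  show "finite (balanced U V \<inter> exps_le D)"
    using finite_subset[OF sub fin] inj by (rule finite_imageD)
  have "card (balanced U V \<inter> exps_le D) \<le> card (PiE W (\<lambda>_. {..D}))"
    by (rule card_inj_on_le[OF inj sub fin])
  also have "\<dots> = (D + 1) ^ (card U + card V - 1)"
    using cW by (simp add: card_PiE)
  finally show "card (balanced U V \<inter> exps_le D) \<le> (D + 1) ^ (card U + card V - 1)" .
qed

lemma keys_mconst: "Poly_Mapping.keys (mconst c) \<subseteq> {0}"
  by (simp add: mconst_def)

lemma keys_mult_balanced:
  assumes "Poly_Mapping.keys p \<subseteq> balanced U V \<inter> exps_le D" "Poly_Mapping.keys q \<subseteq> balanced U V \<inter> exps_le E"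
  shows "Poly_Mapping.keys (p * q) \<subseteq> balanced U V \<inter> exps_le (D + E)"
proof
  fix m assume "m \<in> Poly_Mapping.keys (p * q)"
  then obtain a b where "m = a + b" "a \<in> Poly_Mapping.keys p" "b \<in> Poly_Mapping.keys q"
    using keys_mult[of p q] by blast
  then show "m \<in> balanced U V \<inter> exps_le (D + E)"
    using assms balanced_add exps_le_add by blast
qed

lemma keys_one_balanced: "Poly_Mapping.keys (1 :: ('v, 'k::zero_neq_one) mpoly) \<subseteq> balanced U V \<inter> exps_le D"
  by (auto simp: balanced_0 exps_le_def)

lemma keys_power_balanced:
  fixes p :: "('v, 'k::comm_ring_1) mpoly"
  assumes "Poly_Mapping.keys p \<subseteq> balanced U V \<inter> exps_le D"
  shows "Poly_Mapping.keys (p ^ i) \<subseteq> balanced U V \<inter> exps_le (D * i)"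
proof (induction i)
  case 0
  show ?case using keys_one_balanced by (simp del: keys_one)
next
  case (Suc i)
  then show ?case using keys_mult_balanced[OF assms Suc] by simp
qed

lemma keys_prod_balanced:
  fixes p :: "'a \<Rightarrow> ('v, 'k::comm_ring_1) mpoly"
  assumes "\<And>i. i \<in> A \<Longrightarrow> Poly_Mapping.keys (p i) \<subseteq> balanced U V \<inter> exps_le (D i)"
  shows "Poly_Mapping.keys (prod p A) \<subseteq> balanced U V \<inter> exps_le (sum D A)"
  using assms
proof (induction A rule: infinite_finite_induct)
  case (insert x A)
  then show ?case
    using keys_mult_balanced[of "p x" U V "D x" "prod p A" "sum D A"] by simp
qed (use keys_one_balanced in \<open>simp_all del: keys_one\<close>)

lemma keys_power_word_balanced:
  fixes ys :: "('v, 'k::comm_ring_1) mpoly list"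
  assumes "\<And>y. y \<in> set ys \<Longrightarrow> Poly_Mapping.keys y \<subseteq> balanced U V \<inter> exps_le D"
  shows "Poly_Mapping.keys (power_word ys a) \<subseteq> balanced U V \<inter> exps_le (D * sum_list a)"
  using assms
proof (induction ys a rule: list_induct2')
  case (4 y ys i a)
  then show ?case
    using keys_mult_balanced[OF keys_power_balanced[of y U V D i] 4(1)] by (simp add: algebra_simps)
qed (use keys_one_balanced in \<open>simp_all add: power_word_def del: keys_one\<close>)

lemma keys_toric_hom:
  fixes p :: "('e, 'k::field) mpoly"
  assumes UV: "U \<inter> V = {}" "finite U" "finite V"
    and ends: "\<And>e. e \<in> edges G \<Longrightarrow> \<exists>u\<in>U. \<exists>v\<in>V. ends G e = {u, v}"
    and p: "p \<in> carrier (poly_ring (edges G))"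
  shows "\<exists>D. Poly_Mapping.keys (toric_hom G p) \<subseteq> balanced U V \<inter> exps_le D"
proof -
  let ?x = "\<lambda>e. \<Prod>v\<in>ends G e. mvar v :: ('a, 'k) mpoly"
  have edge: "Poly_Mapping.keys (?x e) \<subseteq> balanced U V \<inter> exps_le 1" if e: "e \<in> edges G" for e
  proof -
    obtain u v where uv: "u \<in> U" "v \<in> V" "ends G e = {u, v}" using ends[OF e] by blast
    then have "u \<noteq> v" "u \<notin> V" "v \<notin> U" using UV by auto
    then have x: "?x e = Poly_Mapping.single (Poly_Mapping.single u 1 + Poly_Mapping.single v 1) 1"
      using uv by (simp add: mvar_def mult_single)
    have "Poly_Mapping.keys (Poly_Mapping.single u 1 + Poly_Mapping.single v (1::nat)) \<subseteq> U \<union> V"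
      using keys_add[of "Poly_Mapping.single u 1" "Poly_Mapping.single v (1::nat)"] uv by auto
    then show ?thesis
      using uv UV \<open>u \<noteq> v\<close> \<open>u \<notin> V\<close> \<open>v \<notin> U\<close> unfolding x
      by (auto simp: balanced_def exps_le_def lookup_add lookup_single when_def sum.distrib)
  qed
  \<comment> \<open>The factor \<open>1\<close> is the bound on the exponents in the image of a single edge.\<close>
  define D where "D m = (\<Sum>e\<in>Poly_Mapping.keys m. 1 * Poly_Mapping.lookup m e)" for m :: "'e \<Rightarrow>\<^sub>0 nat"
  have summand: "Poly_Mapping.keys (mconst c * subst_monom ?x m) \<subseteq> balanced U V \<inter> exps_le (D m)"
    if m: "m \<in> Poly_Mapping.keys p" for m and c :: 'k
  proof -
    have "Poly_Mapping.keys (subst_monom ?x m) \<subseteq> balanced U V \<inter> exps_le (D m)"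
      unfolding subst_monom_def D_def
      by (intro keys_prod_balanced keys_power_balanced edge) (use p m in \<open>auto simp: poly_ring_carrier\<close>)
    moreover have "Poly_Mapping.keys (mconst c :: ('a, 'k) mpoly) \<subseteq> balanced U V \<inter> exps_le 0"
      using keys_mconst[of c] balanced_0 by (auto simp: exps_le_def)
    ultimately show ?thesis using keys_mult_balanced[of _ U V 0 _ "D m"] by simp
  qed
  have mono: "exps_le (D m) \<subseteq> (exps_le (sum D (Poly_Mapping.keys p)) :: ('a \<Rightarrow>\<^sub>0 nat) set)"
    if "m \<in> Poly_Mapping.keys p" for m
    by (rule exps_le_mono, rule member_le_sum) (use that in auto)
  have "toric_hom G p = (\<Sum>m\<in>Poly_Mapping.keys p. mconst (Poly_Mapping.lookup p m) * subst_monom ?x m)"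
    unfolding toric_hom_def by (rule poly_hom_superset) auto
  also have "Poly_Mapping.keys \<dots> \<subseteq> balanced U V \<inter> exps_le (sum D (Poly_Mapping.keys p))"
    by (rule order_trans[OF keys_sum]) (use summand mono in blast)
  finally show ?thesis by blast
qed

lemma poly_hom_power_word: "poly_hom f (power_word xs a) = power_word (map (poly_hom f) xs) a"
  by (induction xs a rule: list_induct2') (simp_all add: power_word_def poly_hom_mult poly_hom_power)

lemma sum_list_words: "a \<in> words M k \<Longrightarrow> sum_list a \<le> k * M"
  using sum_list_mono[of a "\<lambda>x. x" "\<lambda>_. M"]
  by (auto simp: words_def sum_list_triv subset_iff less_imp_le)

lemma toric_ideal_eq: "toric_ideal G = {p \<in> carrier (poly_ring (edges G)). toric_hom G p = 0}"
  by (simp add: toric_ideal_def a_kernel_def')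

text \<open>
  Let \<open>E\<close> bound the exponents in the images of the \<open>k\<close> given elements.  The \<open>M ^ k\<close> monomials in these
  elements with exponents below \<open>M\<close> have images in the span of the balanced monomials with
  exponents at most \<open>E * k * M\<close>.  There are at most \<open>(E * k * M + 1) ^ N\<close> of those, where \<open>N < k\<close>, so
  for large \<open>M\<close> there are more images than dimensions.
\<close>
lemma toric_algebraic_dependence:
  fixes xs :: "('e, 'k::field) mpoly list"
  assumes UV: "U \<inter> V = {}" "finite U" "finite V" "U \<noteq> {}"
    and ends: "\<And>e. e \<in> edges G \<Longrightarrow> \<exists>u\<in>U. \<exists>v\<in>V. ends G e = {u, v}"
    and xs: "set xs \<subseteq> carrier (poly_ring (edges G))" "length xs \<ge> card U + card V"
  shows "\<exists>M c. (\<exists>a\<in>words M (length xs). c a \<noteq> 0) \<and>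
    (\<Sum>a\<in>words M (length xs). mconst (c a) * power_word xs a) \<in> toric_ideal G"
proof -
  let ?k = "length xs" and ?N = "card U + card V - 1"
  have "\<forall>x\<in>set xs. \<exists>D. Poly_Mapping.keys (toric_hom G x) \<subseteq> balanced U V \<inter> exps_le D"
    using keys_toric_hom[OF UV(1-3) ends] xs(1) by blast
  then obtain D where D: "\<And>x. x \<in> set xs \<Longrightarrow> Poly_Mapping.keys (toric_hom G x) \<subseteq> balanced U V \<inter> exps_le (D x)"
    by metis
  define E where "E = sum D (set xs)"
  have "exps_le (D x) \<subseteq> (exps_le E :: ('a \<Rightarrow>\<^sub>0 nat) set)" if "x \<in> set xs" for x
    unfolding E_def by (rule exps_le_mono, rule member_le_sum) (use that in auto)
  with D have E: "Poly_Mapping.keys (toric_hom G x) \<subseteq> balanced U V \<inter> exps_le E" if "x \<in> set xs" for x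
    using that by blast
  \<comment> \<open>Chosen so that \<open>(E * k * M + 1) ^ N \<le> (E * k + 1) ^ N * M ^ N < M ^ Suc N\<close>.\<close>
  define M where "M = (E * ?k + 1) ^ ?N + 1"
  define B where "B = balanced U V \<inter> exps_le (E * (?k * M))"
  have "card B \<le> (E * (?k * M) + 1) ^ ?N" "finite B"
    unfolding B_def using card_balanced[OF UV(2,3,1,4)] by blast+
  note this(1)
  also have "(E * (?k * M) + 1) ^ ?N \<le> ((E * ?k + 1) * M) ^ ?N"
    by (rule power_mono) (simp_all add: M_def algebra_simps)
  also have "\<dots> = (E * ?k + 1) ^ ?N * M ^ ?N" by (rule power_mult_distrib)
  also have "\<dots> < M * M ^ ?N" by (rule mult_strict_right_mono) (simp_all add: M_def)
  also have "\<dots> \<le> M ^ ?k"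
    unfolding power_Suc[symmetric] using xs(2) UV
    by (intro power_increasing) (auto simp: M_def Suc_le_eq card_gt_0_iff)
  finally have card: "card B < card (words M ?k)" by (simp add: card_words)
  define f where "f a = Poly_Mapping.lookup (toric_hom G (power_word xs a))" for a
  obtain c where c: "\<exists>a\<in>words M ?k. c a \<noteq> 0" "\<And>b. b \<in> B \<Longrightarrow> (\<Sum>a\<in>words M ?k. c a * f a b) = 0"
    using underdetermined_linear_system[OF \<open>finite B\<close> finite_words card, of f] by blast
  have f0: "f a b = 0" if a: "a \<in> words M ?k" and b: "b \<notin> B" for a b
  proof -
    have "Poly_Mapping.keys (toric_hom G (power_word xs a)) \<subseteq> balanced U V \<inter> exps_le (E * sum_list a)"
      unfolding toric_hom_def poly_hom_power_word
      by (rule keys_power_word_balanced) (use E in \<open>auto simp: toric_hom_def\<close>)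
    also have "exps_le (E * sum_list a) \<subseteq> (exps_le (E * (?k * M)) :: ('a \<Rightarrow>\<^sub>0 nat) set)"
      by (intro exps_le_mono mult_le_mono2 sum_list_words a)
    finally have "b \<notin> Poly_Mapping.keys (toric_hom G (power_word xs a))" using b by (auto simp: B_def)
    then show ?thesis by (simp add: f_def in_keys_iff)
  qed
  let ?r = "\<Sum>a\<in>words M ?k. mconst (c a) * power_word xs a"
  have "toric_hom G ?r = 0"
  proof (rule poly_mapping_eqI)
    fix b
    have "Poly_Mapping.lookup (toric_hom G ?r) b = (\<Sum>a\<in>words M ?k. c a * f a b)"
      by (simp add: toric_hom_def poly_hom_sum poly_hom_mult lookup_sum lookup_mconst_mult f_def)
    also have "\<dots> = 0" using c(2) f0 by (cases "b \<in> B") auto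
    finally show "Poly_Mapping.lookup (toric_hom G ?r) b = Poly_Mapping.lookup 0 b" by simp
  qed
  moreover have "?r \<in> carrier (poly_ring (edges G))"
    by (intro poly_ring_closed_sum poly_ring_closed power_word_closed xs(1))
  ultimately have "?r \<in> toric_ideal G" by (simp add: toric_ideal_eq)
  then show ?thesis using c(1) by blast
qed

text \<open>
  In a longer chain, one element from each step would give a list that is both dependent and
  independent.
\<close>
lemma toric_prime_chain_length:
  fixes G :: "('v, 'e) graph"
  assumes UV: "U \<inter> V = {}" "finite U" "finite V" "U \<noteq> {}"
    and ends: "\<And>e. e \<in> edges G \<Longrightarrow> \<exists>u\<in>U. \<exists>v\<in>V. ends G e = {u, v}"
    and chain: "prime_chain_above (poly_ring (edges G)) (toric_ideal G :: ('e, 'k::field) mpoly set) d"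
  shows "d < card U + card V"
proof (rule ccontr)
  assume d: "\<not> d < card U + card V"
  obtain P where P: "\<And>i. i \<le> d \<Longrightarrow> primeideal (P i) (poly_ring (edges G)) \<and> (toric_ideal G :: ('e, 'k) mpoly set) \<subseteq> P i"
    "\<And>i. i < d \<Longrightarrow> P i \<subset> P (Suc i)" using chain unfolding prime_chain_above_def by blast
  have "\<forall>i. \<exists>x. i < d \<longrightarrow> x \<in> P (Suc i) - P i" using P(2) by blast
  then obtain x where x: "\<And>i. i < d \<Longrightarrow> x i \<in> P (Suc i) - P i" by metis
  define xs where "xs = map x [0..<d]"
  have len: "length xs = d" and nth: "\<And>i. i < d \<Longrightarrow> xs ! i = x i" by (simp_all add: xs_def)
  have "x i \<in> carrier (poly_ring (edges G))" if "i < d" for i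
    using primeideal_poly_ring(1)[OF conjunct1[OF P(1)[of "Suc i"]]] x[OF that] that by auto
  then have sub: "set xs \<subseteq> carrier (poly_ring (edges G))" by (auto simp: xs_def)
  have "card U + card V \<le> length xs" using d len by simp
  from toric_algebraic_dependence[OF UV ends sub this, unfolded len]
  obtain M c a where "a \<in> words M d" "c a \<noteq> 0"
    "(\<Sum>a\<in>words M d. mconst (c a) * power_word xs a) \<in> toric_ideal G"
    by blast
  moreover have "c a = 0"
  proof (rule prime_chain_algebraically_independent[where xs = xs and P = P and M = M and X = "edges G"])
    show "(\<Sum>a\<in>words M (length xs). mconst (c a) * power_word xs a) \<in> P 0"
      using calculation(3) P(1)[of 0] len by auto
    show "a \<in> words M (length xs)" using calculation(1) len by simp
    show "primeideal (P i) (poly_ring (edges G))" if "i \<le> length xs" for i using P(1) that len by blast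
    show "P i \<subseteq> P (Suc i)" if "i < length xs" for i using P(2) that len by blast
    show "xs ! i \<in> P (Suc i) - P i" if "i < length xs" for i using x nth that len by simp
  qed
  ultimately show False by simp
qed

section \<open>Chains of primes from orderings of the vertices\<close>

text \<open>
  The substitution that sets all vertices of rank \<open>i\<close> and more to zero and renames the others by
  their rank.  The target has the linearly ordered variables that make it an integral domain.
\<close>
definition vertex_cut :: "('v \<Rightarrow> nat) \<Rightarrow> nat \<Rightarrow> 'v \<Rightarrow> (nat, 'k::field) mpoly" where
  "vertex_cut rank i v = (if rank v < i then mvar (rank v) else 0)"

lemma poly_hom_vertex_cut:
  "poly_hom (vertex_cut rank i) (toric_hom G p) = poly_hom (\<lambda>e. \<Prod>v\<in>ends G e. vertex_cut rank i v) p"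
  by (simp add: toric_hom_def poly_hom_poly_hom poly_hom_prod)

lemma mvar_nonzero: "(mvar x :: ('x, 'k::field) mpoly) \<noteq> 0"
  by (simp add: mvar_def flip: keys_eq_empty)

text \<open>
  The primes are the kernels of the toric homomorphism followed by \<open>vertex_cut rank i\<close>.  They shrink
  as \<open>i\<close> grows, since the smaller cut factors through the larger one.  An edge whose highest vertex
  has rank \<open>j + 1\<close> vanishes under the cut at \<open>j + 1\<close> and survives, as a product of variables, under
  the cut at \<open>j + 2\<close>.
\<close>
lemma toric_prime_chain_exists:
  fixes rank :: "'v \<Rightarrow> nat" and G :: "('v, 'e) graph"
  assumes edge: "\<And>j. j < d \<Longrightarrow>
    \<exists>e\<in>edges G. finite (ends G e) \<and> ends G e \<noteq> {} \<and> Max (rank ` ends G e) = Suc j"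
  shows "prime_chain_above (poly_ring (edges G)) (toric_ideal G :: ('e, 'k::field) mpoly set) d"
proof -
  define Q :: "nat \<Rightarrow> ('e, 'k) mpoly set" where
    "Q i = subst_kernel (edges G) (\<lambda>e. \<Prod>v\<in>ends G e. vertex_cut rank i v)" for i
  have Q: "p \<in> Q i \<longleftrightarrow> p \<in> carrier (poly_ring (edges G)) \<and> poly_hom (vertex_cut rank i) (toric_hom G p) = 0"
    for p i by (simp add: Q_def subst_kernel_def poly_hom_vertex_cut)
  have mono: "Q (Suc i) \<subseteq> Q i" for i
  proof
    fix p assume p: "p \<in> Q (Suc i)"
    have "vertex_cut rank i = (\<lambda>v. poly_hom (vertex_cut id i) (vertex_cut rank (Suc i) v :: (nat, 'k) mpoly))"
      by (auto simp: vertex_cut_def fun_eq_iff)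
    then have "poly_hom (vertex_cut rank i) (toric_hom G p)
        = poly_hom (vertex_cut id i) (poly_hom (vertex_cut rank (Suc i)) (toric_hom G p))"
      by (simp add: poly_hom_poly_hom)
    then show "p \<in> Q i" using p by (simp add: Q)
  qed
  have strict: "Q (Suc (Suc j)) \<subset> Q (Suc j)" if j: "j < d" for j
  proof -
    obtain e where e: "e \<in> edges G" and fin: "finite (ends G e)" and max: "ends G e \<noteq> {}" "Max (rank ` ends G e) = Suc j"
      using edge[OF j] by blast
    have "Suc j \<in> rank ` ends G e"
      using Max_in[of "rank ` ends G e"] fin max by simp
    then obtain w where w: "w \<in> ends G e" "rank w = Suc j" by auto
    have le: "rank v \<le> Suc j" if "v \<in> ends G e" for v
      using Max_ge[of "rank ` ends G e" "rank v"] fin max that by auto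
    have hom: "poly_hom (vertex_cut rank i) (toric_hom G (mvar e :: ('e, 'k) mpoly)) = (\<Prod>v\<in>ends G e. vertex_cut rank i v)" for i
      by (simp add: toric_hom_def poly_hom_prod)
    have "(\<Prod>v\<in>ends G e. vertex_cut rank (Suc j) v :: (nat, 'k) mpoly) = 0"
      using fin w by (auto simp: vertex_cut_def intro!: bexI[of _ w])
    moreover have "(\<Prod>v\<in>ends G e. vertex_cut rank (Suc (Suc j)) v :: (nat, 'k) mpoly) \<noteq> 0"
      using fin le by (auto simp: vertex_cut_def mvar_nonzero less_Suc_eq_le)
    ultimately have "mvar e \<in> Q (Suc j) - Q (Suc (Suc j))"
      using e by (simp add: Q hom poly_ring_closed)
    then show ?thesis using mono by blast
  qed
  have prime: "primeideal (Q i) (poly_ring (edges G))" "toric_ideal G \<subseteq> Q i" for i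
    unfolding Q_def by (rule primeideal_subst_kernel)
      (auto simp: subst_kernel_def toric_ideal_eq simp flip: poly_hom_vertex_cut)
  show ?thesis
    unfolding prime_chain_above_def
  proof (intro exI[of _ "\<lambda>i. Q (Suc (d - i))"] conjI allI impI)
    fix i assume "i < d"
    then show "Q (Suc (d - i)) \<subset> Q (Suc (d - Suc i))"
      using strict[of "d - Suc i"] by (simp add: Suc_diff_Suc)
  qed (use prime in auto)
qed

section \<open>The ideal of polynomials without constant term\<close>

lemma poly_hom_zero:
  fixes p :: "('a, 'c::comm_ring_1) mpoly"
  shows "poly_hom (\<lambda>_. 0 :: ('b, 'c) mpoly) p = mconst (Poly_Mapping.lookup p 0)"
proof -
  have "subst_monom (\<lambda>_. 0) m = (0 :: ('b, 'c) mpoly)" if m: "m \<noteq> 0" for m :: "'a \<Rightarrow>\<^sub>0 nat"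
  proof -
    obtain x where "x \<in> Poly_Mapping.keys m" using m by (metis keys_eq_empty ex_in_conv)
    then show ?thesis
      unfolding subst_monom_def by (intro prod_zero) (auto simp: in_keys_iff zero_power)
  qed
  then have summand: "mconst (Poly_Mapping.lookup p m) * subst_monom (\<lambda>_. 0) m
      = (if m = 0 then mconst (Poly_Mapping.lookup p 0) else 0 :: ('b, 'c) mpoly)" for m
    by simp
  have "poly_hom (\<lambda>_. 0 :: ('b, 'c) mpoly) p =
      (\<Sum>m\<in>insert 0 (Poly_Mapping.keys p). mconst (Poly_Mapping.lookup p m) * subst_monom (\<lambda>_. 0) m)"
    by (rule poly_hom_superset) auto
  also have "\<dots> = mconst (Poly_Mapping.lookup p 0)"
    unfolding summand by simp
  finally show ?thesis .
qed

text \<open>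
  A prime containing all variables contains every polynomial without constant term; it contains no
  polynomial with a nonzero constant term, because it would then contain that constant, a unit.
\<close>
lemma primeideal_all_variables:
  fixes P :: "('x, 'k::field) mpoly set"
  assumes P: "primeideal P (poly_ring X)" and var: "\<And>x. x \<in> X \<Longrightarrow> mvar x \<in> P"
  shows "P = subst_kernel X (\<lambda>_. 0 :: (nat, 'k) mpoly)"
proof -
  note P' = primeideal_poly_ring[OF P]
  have monom: "Poly_Mapping.single m c \<in> P" if m: "m \<noteq> 0" "Poly_Mapping.keys m \<subseteq> X" for m c
  proof -
    obtain x where x: "x \<in> Poly_Mapping.keys m" using m(1) by (metis keys_eq_empty ex_in_conv)
    define m' where "m' = m - Poly_Mapping.single x 1"
    have m': "m = m' + Poly_Mapping.single x 1"
      using x by (intro poly_mapping_eqI) (auto simp: m'_def lookup_add lookup_minus lookup_single when_def in_keys_iff)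
    have "Poly_Mapping.keys m' \<subseteq> Poly_Mapping.keys m"
      by (auto simp: m' in_keys_iff lookup_add)
    then have "Poly_Mapping.single m' c \<in> carrier (poly_ring X)"
      using m(2) by (auto simp: poly_ring_carrier)
    then have "Poly_Mapping.single m' c * mvar x \<in> P" using P'(5) var x m(2) by blast
    then show ?thesis by (simp add: m' mvar_def mult_single)
  qed
  have sum: "sum f A \<in> P" if "\<And>i. i \<in> A \<Longrightarrow> f i \<in> P" for f and A :: "('x \<Rightarrow>\<^sub>0 nat) set"
    using that P'(2,3) by (induction A rule: infinite_finite_induct) auto
  have "p \<in> P \<longleftrightarrow> p \<in> carrier (poly_ring X) \<and> Poly_Mapping.lookup p 0 = 0" for p
  proof (cases "p \<in> carrier (poly_ring X)")
    case True
    define q where "q = (\<Sum>m\<in>Poly_Mapping.keys p - {0}. Poly_Mapping.single m (Poly_Mapping.lookup p m))"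
    have q: "q \<in> P" unfolding q_def by (intro sum monom) (use True in \<open>auto simp: poly_ring_carrier\<close>)
    have p: "p = q + mconst (Poly_Mapping.lookup p 0)"
    proof -
      have "p = (\<Sum>m\<in>insert 0 (Poly_Mapping.keys p). Poly_Mapping.single m (Poly_Mapping.lookup p m))"
        by (subst poly_mapping_sum_single) (auto intro!: sum.mono_neutral_left simp: in_keys_iff)
      also have "\<dots> = mconst (Poly_Mapping.lookup p 0) + q"
        unfolding q_def mconst_def by (subst sum.insert_remove) simp_all
      finally show ?thesis by (simp only: add.commute)
    qed
    have "Poly_Mapping.lookup p 0 = 0" if "p \<in> P"
    proof (rule ccontr)
      assume c: "Poly_Mapping.lookup p 0 \<noteq> 0"
      have "mconst (Poly_Mapping.lookup p 0) \<in> P" using P'(4)[OF that q] p by (metis add_diff_cancel_left')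
      then have "mconst (1 / Poly_Mapping.lookup p 0) * mconst (Poly_Mapping.lookup p 0) \<in> P"
        by (rule P'(5)) (rule poly_ring_closed)
      then have "mconst (1 / Poly_Mapping.lookup p 0 * Poly_Mapping.lookup p 0) \<in> P"
        by (simp only: mconst_simps)
      then show False using c P'(7) by simp
    qed
    moreover have "p \<in> P" if "Poly_Mapping.lookup p 0 = 0" using p q that by simp
    ultimately show ?thesis using True by blast
  qed (use P'(1) in blast)
  then show ?thesis
    by (auto simp: subst_kernel_def poly_hom_zero mconst_def simp flip: keys_eq_empty)
qed

section \<open>Corners and minors of the ladder\<close>

text \<open>
  A rectangle of entries with one diagonal \<open>a\<close>, \<open>2m + 4\<close> and the other \<open>2m + 2\<close>, \<open>2m + 3\<close>.  Which of the
  last two stands in the upper right corner depends on the parity of \<open>m\<close>: rows are added for even \<open>m\<close>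
  and columns for odd \<open>m\<close>.
\<close>
definition has_minor :: "(nat \<times> nat \<rightharpoonup> nat) \<Rightarrow> nat \<Rightarrow> bool" where
  "has_minor L m \<longleftrightarrow> (\<exists>r c r' c' a.
     L (r, c) = Some a \<and> L (r', c') = Some (2 * m + 4) \<and>
     (L (r, c') = Some (2 * m + 2) \<and> L (r', c) = Some (2 * m + 3) \<or>
      L (r, c') = Some (2 * m + 3) \<and> L (r', c) = Some (2 * m + 2)))"

lemma map_le_Some:
  assumes "L \<subseteq>\<^sub>m L'" "L p = Some x"
  shows "L' p = Some x"
proof -
  have "L p = L' p" using assms(1) domI[of L, OF assms(2)] unfolding map_le_def by (rule bspec)
  then show ?thesis using assms(2) by (rule subst)
qed

lemma has_minor_mono:
  assumes "L \<subseteq>\<^sub>m L'" "has_minor L m"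
  shows "has_minor L' m"
proof -
  obtain r c r' c' a where L: "L (r, c) = Some a" "L (r', c') = Some (2 * m + 4)"
    "L (r, c') = Some (2 * m + 2) \<and> L (r', c) = Some (2 * m + 3) \<or>
     L (r, c') = Some (2 * m + 3) \<and> L (r', c) = Some (2 * m + 2)"
    using assms(2) unfolding has_minor_def by (elim exE conjE)
  note up = map_le_Some[OF assms(1)]
  have "L' (r, c') = Some (2 * m + 2) \<and> L' (r', c) = Some (2 * m + 3) \<or>
     L' (r, c') = Some (2 * m + 3) \<and> L' (r', c) = Some (2 * m + 2)"
    using L(3) by (elim disj_forward conj_forward up)
  then show ?thesis
    unfolding has_minor_def using up[OF L(1)] up[OF L(2)] by blast
qed

text \<open>
  If step \<open>n\<close> adds a row, its two entries stand below two entries of the previous row: \<open>2n + 3\<close> below the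
  picked entry \<open>a\<close>, and \<open>2n + 4\<close> below the previous corner, which is numbered \<open>2(n - 1) + 4 = 2n + 2\<close>.
  These four entries form the rectangle.  Columns are transposed rows.
\<close>
lemma ladder_step:
  assumes n: "n = Suc (Suc m)" and L: "L = ladder (Suc m) (butlast t)"
    and corner: "L (num_rows (Suc m), num_cols (Suc m)) = Some (2 * n + 2)"
  shows "L \<subseteq>\<^sub>m ladder n t" "ladder n t (num_rows n, num_cols n) = Some (2 * n + 4)"
    "has_minor (ladder n t) n"
proof -
  define r c where "r = num_rows n" and "c = num_cols n"
  have inv: "ladder_inv (Suc m) L" unfolding L by (rule ladder_inv_ladder)
  have "L \<subseteq>\<^sub>m ladder n t \<and> ladder n t (r, c) = Some (2 * n + 4) \<and> has_minor (ladder n t) n"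
  proof (cases "even n")
    case True
    have d: "dom L \<subseteq> {1..r - 1} \<times> {1..c}" and card: "card {j. (r - 1, j) \<in> dom L} \<ge> 3"
      and r: "r > 2" and cor: "L (r - 1, c) = Some (2 * n + 2)"
      using inv corner True
      by (auto simp: ladder_inv_def n r_def c_def num_rows_def num_cols_def)
    define j where "j = pick (last t) {j. (r - 1, j) \<in> dom L}"
    have "{j. (r - 1, j) \<in> dom L} \<subseteq> {1..c}" using d by auto
    from pick_less[OF this card] have j: "j < c" "(r - 1, j) \<in> dom L" by (auto simp: j_def)
    have eq: "ladder n t = L((r, j) \<mapsto> 2 * n + 3, (r, c) \<mapsto> 2 * n + 4)"
      using True by (simp add: n L r_def c_def j_def Let_def)
    have fresh: "(r, j') \<notin> dom L" for j' using d r by fastforce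
    obtain a where a: "L (r - 1, j) = Some a" using j(2) by auto
    have le: "L \<subseteq>\<^sub>m ladder n t" using fresh unfolding eq by (auto simp: map_le_def)
    have new: "ladder n t (r, c) = Some (2 * n + 4)" "ladder n t (r, j) = Some (2 * n + 3)"
      using j(1) by (simp_all add: eq)
    have "has_minor (ladder n t) n"
      unfolding has_minor_def
      by (rule exI[of _ "r - 1"], rule exI[of _ j], rule exI[of _ r], rule exI[of _ c], rule exI[of _ a])
        (use map_le_Some[OF le a] map_le_Some[OF le cor] new in blast)
    then show ?thesis using le new by blast
  next
    case False
    have d: "dom L \<subseteq> {1..r} \<times> {1..c - 1}" and card: "card {i. (i, c - 1) \<in> dom L} \<ge> 3"
      and c: "c > 2" and cor: "L (r, c - 1) = Some (2 * n + 2)"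
      using inv corner False
      by (auto simp: ladder_inv_def n r_def c_def num_rows_def num_cols_def)
    define i where "i = pick (last t) {i. (i, c - 1) \<in> dom L}"
    have "{i. (i, c - 1) \<in> dom L} \<subseteq> {1..r}" using d by auto
    from pick_less[OF this card] have i: "i < r" "(i, c - 1) \<in> dom L" by (auto simp: i_def)
    have eq: "ladder n t = L((i, c) \<mapsto> 2 * n + 3, (r, c) \<mapsto> 2 * n + 4)"
      using False by (simp add: n L r_def c_def i_def Let_def)
    have fresh: "(i', c) \<notin> dom L" for i' using d c by fastforce
    obtain a where a: "L (i, c - 1) = Some a" using i(2) by auto
    have le: "L \<subseteq>\<^sub>m ladder n t" using fresh unfolding eq by (auto simp: map_le_def)
    have new: "ladder n t (r, c) = Some (2 * n + 4)" "ladder n t (i, c) = Some (2 * n + 3)"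
      using i(1) by (simp_all add: eq)
    have "has_minor (ladder n t) n"
      unfolding has_minor_def
      by (rule exI[of _ i], rule exI[of _ "c - 1"], rule exI[of _ r], rule exI[of _ c], rule exI[of _ a])
        (use map_le_Some[OF le a] map_le_Some[OF le cor] new in blast)
    then show ?thesis using le new by blast
  qed
  then show "L \<subseteq>\<^sub>m ladder n t" "ladder n t (num_rows n, num_cols n) = Some (2 * n + 4)"
    "has_minor (ladder n t) n" by (simp_all add: r_def c_def)
qed

lemma ladder_corners_and_minors:
  "ladder n t (1, 1) = Some 0 \<and> ladder n t (1, 2) = Some 2 \<and>
   (\<forall>m\<le>n. ladder n t (num_rows m, num_cols m) = Some (2 * m + 4) \<and> has_minor (ladder n t) m)"
proof (induction n t rule: ladder.induct)
  case (1 t)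
  have "has_minor (ladder 0 t) 0"
    unfolding has_minor_def
    by (rule exI[of _ 1], rule exI[of _ 1], rule exI[of _ 2], rule exI[of _ 2]) simp
  moreover have "ladder 0 t (1, 1) = Some 0" "ladder 0 t (1, 2) = Some 2"
    "ladder 0 t (num_rows 0, num_cols 0) = Some 4"
    by (simp_all add: num_rows_def num_cols_def)
  ultimately show ?case by (simp del: ladder.simps)
next
  case (2 t)
  have "has_minor (ladder (Suc 0) t) 0"
    unfolding has_minor_def
    by (rule exI[of _ 1], rule exI[of _ 1], rule exI[of _ 2], rule exI[of _ 2]) simp
  moreover have "has_minor (ladder (Suc 0) t) (Suc 0)"
    unfolding has_minor_def
    by (rule exI[of _ 1], rule exI[of _ 2], rule exI[of _ 2], rule exI[of _ 3]) simp
  moreover have "ladder (Suc 0) t (1, 1) = Some 0" "ladder (Suc 0) t (1, 2) = Some 2"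
    "ladder (Suc 0) t (num_rows 0, num_cols 0) = Some 4"
    "ladder (Suc 0) t (num_rows (Suc 0), num_cols (Suc 0)) = Some 6"
    by (simp_all add: num_rows_def num_cols_def)
  ultimately show ?case by (simp add: le_Suc_eq del: ladder.simps)
next
  case (3 m t)
  define L n where "L = ladder (Suc m) (butlast t)" and "n = Suc (Suc m)"
  note IH = "3.IH"[OF refl, folded L_def]
  have "L (num_rows (Suc m), num_cols (Suc m)) = Some (2 * n + 2)"
    using IH by (auto simp: n_def)
  note step = ladder_step[OF n_def L_def this]
  have "ladder n t (num_rows k, num_cols k) = Some (2 * k + 4) \<and> has_minor (ladder n t) k"
    if "k \<le> n" for k
  proof (cases "k = n")
    case True
    then show ?thesis using step(2,3) by blast
  next
    case False
    then have "k \<le> Suc m" using that by (simp add: n_def)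
    then show ?thesis using IH map_le_Some[OF step(1)] has_minor_mono[OF step(1)] by blast
  qed
  moreover have "ladder n t (1, 1) = Some 0" "ladder n t (1, 2) = Some 2"
    using IH map_le_Some[OF step(1)] by blast+
  ultimately show ?case unfolding n_def[symmetric] by blast
qed

text \<open>
  Columns and rows alternate, from \<open>0\<close>: column 1, row 1, column 2, row 2, and so on.  The construction
  adds its new vertices in this order, step \<open>m \<ge> 1\<close> the one of rank \<open>m + 3\<close>.
\<close>
definition vertex_rank :: "nat + nat \<Rightarrow> nat" where
  "vertex_rank v = (case v of Inl r \<Rightarrow> 2 * r - 1 | Inr c \<Rightarrow> 2 * c - 2)"

lemma mem_edges_bigraph: "e \<in> edges (bigraph n t) \<longleftrightarrow> (\<exists>r c. ladder n t (r, c) = Some e)"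
  unfolding bigraph_def ran_def by simp

text \<open>
  The edge with index \<open>2j\<close> joins the vertices of rank \<open>j\<close> and \<open>j + 1\<close>: for \<open>j \<ge> 2\<close> it is the corner
  added in step \<open>j - 2\<close>, which connects the newest row with the newest column.
\<close>
lemma bigraph_path:
  assumes j: "j < n + 3"
  shows "\<exists>e\<in>edges (bigraph n t). finite (ends (bigraph n t) e) \<and> ends (bigraph n t) e \<noteq> {} \<and>
    Max (vertex_rank ` ends (bigraph n t) e) = Suc j"
proof -
  note corners = ladder_corners_and_minors[of n t]
  have "\<exists>r c. ladder n t (r, c) = Some (2 * j) \<and> max (vertex_rank (Inl r)) (vertex_rank (Inr c)) = Suc j"
  proof (cases "j < 2")
    case True
    then consider "j = 0" | "j = 1" by linarith
    then show ?thesis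
    proof cases
      case 1
      then show ?thesis using corners by (intro exI[of _ 1]) (simp add: vertex_rank_def)
    next
      case 2
      then show ?thesis using corners
        by (intro exI[of _ 1] exI[of _ 2]) (simp add: vertex_rank_def)
    qed
  next
    case False
    define m where "m = j - 2"
    then have m: "j = m + 2" "m \<le> n" using False j by auto
    have "max (vertex_rank (Inl (num_rows m))) (vertex_rank (Inr (num_cols m))) = Suc j"
      by (cases "even m") (auto simp: m vertex_rank_def num_rows_def num_cols_def elim!: evenE oddE)
    moreover have "ladder n t (num_rows m, num_cols m) = Some (2 * j)"
      using corners m by (auto simp: algebra_simps)
    ultimately show ?thesis by blast
  qed
  then obtain r c where rc: "ladder n t (r, c) = Some (2 * j)"
    "max (vertex_rank (Inl r)) (vertex_rank (Inr c)) = Suc j" by blast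
  have "2 * j \<in> edges (bigraph n t)" unfolding mem_edges_bigraph using rc(1) by blast
  moreover have "finite (ends (bigraph n t) (2 * j))" "ends (bigraph n t) (2 * j) \<noteq> {}"
    "Max (vertex_rank ` ends (bigraph n t) (2 * j)) = Suc j"
    unfolding ends_bigraph[OF rc(1)] using rc(2) by simp_all
  ultimately show ?thesis by blast
qed

lemma bigraph_ends:
  assumes "e \<in> edges (bigraph n t)"
  shows "\<exists>u\<in>Inl ` {1..num_rows n}. \<exists>v\<in>Inr ` {1..num_cols n}. ends (bigraph n t) e = {u, v}"
proof -
  obtain r c where rc: "ladder n t (r, c) = Some e"
    using assms unfolding mem_edges_bigraph by (elim exE)
  have "dom (ladder n t) \<subseteq> {1..num_rows n} \<times> {1..num_cols n}"
    using ladder_inv_ladder[of n t] unfolding ladder_inv_def by (rule conjunct1)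
  then have "(r, c) \<in> {1..num_rows n} \<times> {1..num_cols n}"
    using domI[of "ladder n t", OF rc] by (rule subsetD)
  then have "Inl r \<in> Inl ` {1..num_rows n}" "Inr c \<in> Inr ` {1..num_cols n}" by simp_all
  then show ?thesis using ends_bigraph[OF rc] by (metis (no_types))
qed

lemma toric_hom_mvar:
  assumes "ladder n t (r, c) = Some e"
  shows "toric_hom (bigraph n t) (mvar e) = mvar (Inl r) * (mvar (Inr c) :: (nat + nat, 'k::field) mpoly)"
  unfolding toric_hom_def poly_hom_mvar ends_bigraph[OF assms] by simp

lemma minor_in_toric_ideal:
  assumes "m \<le> n"
  shows "\<exists>a\<in>edges (bigraph n t).
    mvar a * mvar (2 * m + 4) - mvar (2 * m + 2) * mvar (2 * m + 3)
      \<in> (toric_ideal (bigraph n t) :: (nat, 'k::field) mpoly set)"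
proof -
  have "has_minor (ladder n t) m" using ladder_corners_and_minors assms by blast
  then obtain r c r' c' a where L: "ladder n t (r, c) = Some a" "ladder n t (r', c') = Some (2 * m + 4)"
    "ladder n t (r, c') = Some (2 * m + 2) \<and> ladder n t (r', c) = Some (2 * m + 3) \<or>
      ladder n t (r, c') = Some (2 * m + 3) \<and> ladder n t (r', c) = Some (2 * m + 2)"
    unfolding has_minor_def by blast
  let ?p = "mvar a * mvar (2 * m + 4) - mvar (2 * m + 2) * mvar (2 * m + 3) :: (nat, 'k) mpoly"
  have "toric_hom (bigraph n t) ?p = toric_hom (bigraph n t) (mvar a) * toric_hom (bigraph n t) (mvar (2 * m + 4))
      - toric_hom (bigraph n t) (mvar (2 * m + 2)) * toric_hom (bigraph n t) (mvar (2 * m + 3))"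
    by (simp add: toric_hom_def poly_hom_diff poly_hom_mult)
  also have "\<dots> = 0"
    using L(3)
  proof (elim disjE conjE)
    assume *: "ladder n t (r, c') = Some (2 * m + 2)" "ladder n t (r', c) = Some (2 * m + 3)"
    show ?thesis unfolding L(1,2)[THEN toric_hom_mvar] *[THEN toric_hom_mvar] by (simp add: mult_ac)
  next
    assume *: "ladder n t (r, c') = Some (2 * m + 3)" "ladder n t (r', c) = Some (2 * m + 2)"
    show ?thesis unfolding L(1,2)[THEN toric_hom_mvar] *[THEN toric_hom_mvar] by (simp add: mult_ac)
  qed
  finally have "toric_hom (bigraph n t) ?p = 0" .
  moreover have a: "a \<in> edges (bigraph n t)" unfolding mem_edges_bigraph using L(1) by blast
  moreover have "?p \<in> carrier (poly_ring (edges (bigraph n t)))"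
    using assms a by (intro poly_ring_closed_diff poly_ring_closed) (auto simp: edges_bigraph)
  ultimately show ?thesis unfolding toric_ideal_eq by blast
qed

lemma set_X_seq:
  "set (X_seq n) = insert (mvar 0) (insert (mvar (2 * n + 4))
     ((\<lambda>i. mvar (2 * i) - mvar (2 * i + 1)) ` {1..n + 1}))"
proof -
  have "set [1..<n + 2] = {1..n + 1}" by auto
  then show ?thesis unfolding X_seq_def by (simp only: list.set set_append set_map) blast
qed

text \<open>
  The minor of step \<open>m\<close> passes membership from the variable numbered \<open>2m + 4\<close> to the product of those
  numbered \<open>2m + 2\<close> and \<open>2m + 3\<close>; primality gives one of the two and the difference in \<open>X_seq n\<close> the
  other.  The descent starts with the last element of \<open>X_seq n\<close>.
\<close>
lemma variables_in_prime:
  fixes P :: "(nat, 'k::field) mpoly set"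
  assumes P: "primeideal P (poly_ring (edges (bigraph n t)))"
    and I: "toric_ideal (bigraph n t) \<subseteq> P" and X: "set (X_seq n) \<subseteq> P"
    and e: "e \<in> edges (bigraph n t)"
  shows "mvar e \<in> P"
proof -
  note P' = primeideal_poly_ring[OF P]
  have ends: "mvar 0 \<in> P" "mvar (2 * n + 4) \<in> P" using X by (auto simp: set_X_seq)
  have down: "mvar (2 * m + 2) \<in> P \<and> mvar (2 * m + 3) \<in> P" if m: "m \<le> n" and top: "mvar (2 * m + 4) \<in> P" for m
  proof -
    obtain a where a: "a \<in> edges (bigraph n t)"
      "mvar a * mvar (2 * m + 4) - mvar (2 * m + 2) * mvar (2 * m + 3) \<in> P"
      using minor_in_toric_ideal[OF m] I by blast
    have "mvar a * mvar (2 * m + 4) \<in> P" by (rule P'(5)[OF top]) (rule poly_ring_closed(2)[OF a(1)])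
    from P'(4)[OF this a(2)] have "mvar (2 * m + 2) * mvar (2 * m + 3) \<in> P" by simp
    moreover have "mvar (2 * m + 2) \<in> carrier (poly_ring (edges (bigraph n t)))"
      "mvar (2 * m + 3) \<in> carrier (poly_ring (edges (bigraph n t)))"
      using m by (intro poly_ring_closed; simp add: edges_bigraph)+
    ultimately have "mvar (2 * m + 2) \<in> P \<or> mvar (2 * m + 3) \<in> P" by (intro P'(6))
    moreover have "mvar (2 * m + 2) - mvar (2 * m + 3) \<in> P"
    proof -
      have idx: "2 * m + 2 = 2 * (m + 1)" "2 * m + 3 = 2 * (m + 1) + 1" by simp_all
      have "mvar (2 * (m + 1)) - mvar (2 * (m + 1) + 1) \<in> set (X_seq n)"
        unfolding set_X_seq using m by (intro insertI2 imageI) simp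
      then show ?thesis unfolding idx using X by (rule set_mp[rotated])
    qed
    ultimately show ?thesis
      using P'(4)[of "mvar (2 * m + 2)" "mvar (2 * m + 2) - mvar (2 * m + 3)"]
        P'(3)[of "mvar (2 * m + 2) - mvar (2 * m + 3)" "mvar (2 * m + 3)"] by auto
  qed
  have even: "mvar (2 * m + 4) \<in> P" if "m \<le> n" for m
    using that
  proof (induction m rule: inc_induct)
    case (step m)
    have "2 * Suc m + 2 = 2 * m + 4" by simp
    then show ?case using down[of "Suc m"] step by (metis Suc_leI)
  qed (rule ends)
  have "e = 0 \<or> (\<exists>m\<le>n. e = 2 * m + 2 \<or> e = 2 * m + 3 \<or> e = 2 * m + 4)"
  proof -
    have "e = 0 \<or> 2 \<le> e \<and> e \<le> 2 * n + 4" using e by (simp add: edges_bigraph)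
    then show ?thesis by presburger
  qed
  then show ?thesis using ends even down by blast
qed

section \<open>The system of parameters\<close>

lemma ideal_toric_ideal: "ideal (toric_ideal G :: ('e, 'k::field) mpoly set) (poly_ring (edges G))"
proof -
  have "toric_ideal G = a_kernel (poly_ring (edges G)) (poly_ring UNIV) (toric_hom G :: ('e, 'k) mpoly \<Rightarrow> _)"
    by (simp add: toric_ideal_eq a_kernel_def')
  then show ?thesis
    unfolding toric_hom_def
    using ring_hom_ring.kernel_is_ideal[OF ring_hom_poly_hom[of "\<lambda>e. \<Prod>v\<in>ends G e. mvar v" "edges G" UNIV]]
    by simp
qed

lemma prime_chain_toric_ring:
  "prime_chain (toric_ring G :: ('e, 'k::field) mpoly set ring) d \<longleftrightarrow>
    prime_chain_above (poly_ring (edges G)) (toric_ideal G :: ('e, 'k) mpoly set) d"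
  using cring.prime_chain_above_quot[OF cring_poly_ring ideal_toric_ideal empty_subsetI, of G d]
  unfolding toric_ring_def by (simp only: image_empty Un_empty_right prime_chain_above_empty)

lemma prime_chain_toric_quotient:
  fixes X :: "('e, 'k::field) mpoly set"
  assumes "X \<subseteq> carrier (poly_ring (edges G))"
  shows "prime_chain (toric_ring G Quot Idl\<^bsub>toric_ring G\<^esub> (toric_class G ` X)) d \<longleftrightarrow>
    prime_chain_above (poly_ring (edges G)) (toric_ideal G \<union> X) d"
proof -
  have "toric_class G = (+>\<^bsub>poly_ring (edges G)\<^esub>) (toric_ideal G :: ('e, 'k) mpoly set)"
    by (rule ext) (rule toric_class_def)
  then show ?thesis
    unfolding toric_ring_def
    by (simp only: cring.prime_chain_quot_quot[OF cring_poly_ring ideal_toric_ideal assms])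
qed

text \<open>
  Setting all variables to zero factors through the toric homomorphism, because it agrees with
  setting all vertices to zero.
\<close>
lemma toric_ideal_no_constants:
  fixes G :: "('v, 'e) graph"
  assumes "\<And>e. e \<in> edges G \<Longrightarrow> finite (ends G e) \<and> ends G e \<noteq> {}"
  shows "toric_ideal G \<subseteq> subst_kernel (edges G) (\<lambda>_. 0 :: ('y, 'k::field) mpoly)"
proof
  fix p :: "('e, 'k) mpoly" assume p: "p \<in> toric_ideal G"
  then have pc: "p \<in> carrier (poly_ring (edges G))" "toric_hom G p = 0"
    unfolding toric_ideal_eq by blast+
  have "(\<Prod>v\<in>ends G e. 0 :: ('y, 'k) mpoly) = 0" if "e \<in> edges G" for e
    using assms[OF that] by (simp add: zero_power card_gt_0_iff)
  then have "poly_hom (\<lambda>_. 0 :: ('y, 'k) mpoly) p = poly_hom (\<lambda>e. \<Prod>v\<in>ends G e. 0) p"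
    by (intro poly_hom_cong[OF pc(1)]) (rule sym)
  also have "\<dots> = poly_hom (\<lambda>_. 0) (toric_hom G p)"
    by (simp add: toric_hom_def poly_hom_poly_hom poly_hom_prod)
  finally show "p \<in> subst_kernel (edges G) (\<lambda>_. 0 :: ('y, 'k) mpoly)"
    using pc by (simp add: subst_kernel_def)
qed

lemma X_seq_linear:
  fixes p :: "(nat, 'k::field) mpoly"
  assumes "p \<in> set (X_seq n)"
  shows "p \<in> carrier (poly_ring (edges (bigraph n t)))" "homogeneous 1 p"
proof -
  have var: "homogeneous 1 (mvar i :: (nat, 'k) mpoly)" for i :: nat
    by (simp add: homogeneous_def mvar_def)
  have diff: "homogeneous 1 (mvar i - mvar j :: (nat, 'k) mpoly)" for i j :: nat
    using var[of i] var[of j] keys_diff[of "mvar i :: (nat, 'k) mpoly" "mvar j"]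
    unfolding homogeneous_def by blast
  have edge: "i \<in> edges (bigraph n t)" if "i = 0 \<or> 2 \<le> i \<and> i \<le> 2 * n + 4" for i
    using that by (simp add: edges_bigraph)
  from assms consider "p = mvar 0" | "p = mvar (2 * n + 4)"
    | i where "p = mvar (2 * i) - mvar (2 * i + 1)" "1 \<le> i" "i \<le> n + 1"
    unfolding set_X_seq by auto
  then have "p \<in> carrier (poly_ring (edges (bigraph n t))) \<and> homogeneous 1 p"
  proof cases
    case 3
    have "2 * i \<in> edges (bigraph n t)" "2 * i + 1 \<in> edges (bigraph n t)"
      using 3(2,3) by (intro edge; simp)+
    then show ?thesis unfolding 3(1) by (intro conjI diff poly_ring_closed_diff poly_ring_closed(2))
  qed (use var edge in \<open>simp_all add: poly_ring_closed(2)\<close>)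
  then show "p \<in> carrier (poly_ring (edges (bigraph n t)))" "homogeneous 1 p" by blast+
qed

theorem proposition1p3:
  fixes n :: nat and t :: "bit list"
  assumes "length t = n + 1"
  shows "system_of_parameters
           (toric_ring (bigraph n t) :: (nat, 'k::field) mpoly set ring)
           (toric_grading (bigraph n t))
           (map (toric_class (bigraph n t)) (X_seq n))"
proof -
  let ?G = "bigraph n t"
  let ?S = "poly_ring (edges ?G) :: (nat, 'k) mpoly ring"
  let ?I = "toric_ideal ?G :: (nat, 'k) mpoly set"
  let ?X = "set (X_seq n) :: (nat, 'k) mpoly set"
  let ?U = "Inl ` {1..num_rows n} :: (nat + nat) set" and ?V = "Inr ` {1..num_cols n} :: (nat + nat) set"
  have X: "?X \<subseteq> carrier ?S" using X_seq_linear(1) by blast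
  have homog: "\<exists>d>0. x \<in> toric_grading ?G d" if "x \<in> toric_class ?G ` ?X" for x
    using that X_seq_linear unfolding toric_grading_def by (intro exI[of _ 1]) blast
  \<comment> \<open>\<open>n div 2 + (n + 1) div 2 = n\<close>, and rows and columns have two extra each.\<close>
  have card: "card ?U + card ?V = n + 4"
    by (simp add: card_image num_rows_def num_cols_def)
  have len: "length (X_seq n :: (nat, 'k) mpoly list) = n + 3" by (simp add: X_seq_def)
  have "prime_chain_above ?S ?I (n + 3)"
    by (rule toric_prime_chain_exists[OF bigraph_path])
  moreover have "d \<le> n + 3" if chain: "prime_chain_above ?S ?I d" for d
  proof -
    have "d < card ?U + card ?V"
      by (rule toric_prime_chain_length[OF _ _ _ _ bigraph_ends chain]) (auto simp: num_rows_def)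
    then show ?thesis using card by linarith
  qed
  ultimately have dim: "krull_dim (toric_ring ?G :: (nat, 'k) mpoly set ring) = ereal (real (n + 3))"
    by (intro krull_dim_eqI) (simp_all only: prime_chain_toric_ring)
  define m where "m = subst_kernel (edges ?G) (\<lambda>_. 0 :: (nat, 'k) mpoly)"
  have unique: "P = m" if P: "primeideal P ?S" "?I \<union> ?X \<subseteq> P" for P
    unfolding m_def
  proof (rule primeideal_all_variables[OF P(1)])
    fix e assume "e \<in> edges ?G"
    then show "mvar e \<in> P" using P by (intro variables_in_prime) simp_all
  qed
  have "?I \<subseteq> m"
    unfolding m_def by (rule toric_ideal_no_constants) (use bigraph_ends in force)
  moreover have "?X \<subseteq> m"
  proof
    fix p assume p: "p \<in> ?X"
    then have "poly_hom (\<lambda>_. 0) p = (0 :: (nat, 'k) mpoly)"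
      unfolding set_X_seq by (auto simp: poly_hom_diff)
    then show "p \<in> m" using p X by (auto simp: m_def subst_kernel_def)
  qed
  moreover have "primeideal m ?S" unfolding m_def by (rule primeideal_subst_kernel)
  ultimately have "prime_chain_above ?S (?I \<union> ?X) 0"
    unfolding prime_chain_above_def by (intro exI[of _ "\<lambda>_. m"]) simp
  moreover have "d \<le> 0" if chain: "prime_chain_above ?S (?I \<union> ?X) d" for d
  proof (rule ccontr)
    assume d: "\<not> d \<le> 0"
    obtain P where P: "\<And>i. i \<le> d \<Longrightarrow> primeideal (P i) ?S \<and> ?I \<union> ?X \<subseteq> P i"
      "\<And>i. i < d \<Longrightarrow> P i \<subset> P (Suc i)"
      using chain unfolding prime_chain_above_def by blast
    have "P 0 = m" "P (Suc 0) = m" using P(1)[of 0] P(1)[of "Suc 0"] d unique by simp_all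
    then show False using P(2)[of 0] d by simp
  qed
  ultimately have "krull_dim (toric_ring ?G Quot Idl\<^bsub>toric_ring ?G\<^esub> (toric_class ?G ` ?X)) = ereal (real 0)"
    by (intro krull_dim_eqI) (simp_all only: prime_chain_toric_quotient[OF X])
  then show ?thesis
    unfolding system_of_parameters_def using homog dim len by (simp add: zero_ereal_def)
qed

end
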